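(* Let $\mathbb{K}$ be a field, let $d\geq 1$ be an integer, let $V$ be a vector space over $\mathbb{K}$ of dimension $d+1$, and let $\mathcal{A}=\mathrm{End}(V)$ be the $\mathbb{K}$-algebra of all linear transformations from $V$ to $V$. Let $\{E^*_i\}_{i=0}^d$ be a system of mutually orthogonal idempotents in $\mathcal{A}$. Let $A\in\mathcal{A}$ be multiplicity-free, with primitive idempotents $\{E_i\}_{i=0}^d$, and suppose that for $0\leq i,j\leq d$ one has $E^*_iAE^*_j=0$ if $|i-j|>1$ and $E^*_iAE^*_j\neq 0$ if $|i-j|=1$. Let $\{\theta^*_i\}_{i=0}^d$ be scalars in $\mathbb{K}$ and let $A^*=\sum_{i=0}^d\theta^*_iE^*_i$. Let $(E,F)$ be an ordered pair of distinct primitive idempotents of $A$. Then $(E,F)$ is $Q$-polynomial if and only if the following (i)--(iii) hold: (i) $(E,F)$ is a tail; (ii) there exists $\beta\in\mathbb{K}$ such that $\theta^*_{i-1}-\beta\theta^*_i+\theta^*_{i+1}$ is independent of $i$ for $1\leq i\leq d-1$; (iii) $\theta^*_0\neq\theta^*_i$ for $1\leq i\leq d$.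
   Context: The symbol $A^*$ does not denote a conjugate-transpose or adjoint of $A$; it is just the name of another element of $\mathcal{A}$. The scalars $\theta^*_i$ are not assumed to be distinct. A system of mutually orthogonal idempotents in $\mathcal{A}$ is a sequence $\{E^*_i\}_{i=0}^d$ of elements of $\mathcal{A}$ with $E^*_iE^*_j=\delta_{i,j}E^*_i$ and $\mathrm{rank}(E^*_i)=1$ for $0\leq i,j\leq d$. An element of $\mathcal{A}$ is multiplicity-free if it has $d+1$ mutually distinct eigenvalues in $\mathbb{K}$. If $A$ is multiplicity-free with eigenvalues $\theta_0,\ldots,\theta_d$, the primitive idempotent $E_i$ of $A$ corresponding to $\theta_i$ is the element of $\mathcal{A}$ that acts as the identity on the $\theta_i$-eigenspace of $A$ and as zero on the $\theta_j$-eigenspace for all $j\neq i$. A Leonard system on $V$ is a sequence $(A;\{E_i\}_{i=0}^d;A^*;\{E^*_i\}_{i=0}^d)$ such that: (1) each of $A,A^*$ is a multiplicity-free element of $\mathcal{A}$; (2) $\{E_i\}_{i=0}^d$ is an ordering of the primitive idempotents of $A$; (3) $\{E^*_i\}_{i=0}^d$ is an ordering of the primitive idempotents of $A^*$; (4) for $0\leq i,j\leq d$, $E^*_iAE^*_j$ is $0$ if $|i-j|>1$ and nonzero if $|i-j|=1$; (5) for $0\leq i,j\leq d$, $E_iA^*E_j$ is $0$ if $|i-j|>1$ and nonzero if $|i-j|=1$. An ordering $\{E'_i\}_{i=0}^d$ of the primitive idempotents of $A$ is called $Q$-polynomial if $(A;\{E'_i\}_{i=0}^d;A^*;\{E^*_i\}_{i=0}^d)$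 is a Leonard system (with the given ordering of the $E^*_i$). An ordered pair $(E,F)$ of distinct primitive idempotents of $A$ is called $Q$-polynomial if there exists a $Q$-polynomial ordering $\{E'_i\}_{i=0}^d$ of the primitive idempotents of $A$ with $E=E'_0$ and $F=E'_1$. Let $\Delta$ be the graph with vertex set $\{0,1,\ldots,d\}$ in which $i$ and $j$ are adjacent if and only if $i\neq j$ and $E_iA^*E_j\neq 0$ (in this setting this relation is symmetric, so $\Delta$ is a well-defined undirected graph). An ordered pair $(E,F)=(E_i,E_j)$ of distinct primitive idempotents of $A$ is called a tail if in $\Delta$: vertex $i$ is adjacent to no vertex besides $j$; and vertex $j$ is adjacent to at most one vertex besides $i$. *)

theory Defs
  imports Complex_Main
begin

definition End :: "('k::field \<Rightarrow> 'v::ab_group_add \<Rightarrow> 'v) \<Rightarrow> ('v \<Rightarrow> 'v) set" where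
  "End scale = {X. Vector_Spaces.linear scale scale X}"

definition map_rank :: "('k::field \<Rightarrow> 'v::ab_group_add \<Rightarrow> 'v) \<Rightarrow> ('v \<Rightarrow> 'v) \<Rightarrow> nat" where
  "map_rank scale X = vector_space.dim scale (range X)"

definition eigenspace :: "('k::field \<Rightarrow> 'v::ab_group_add \<Rightarrow> 'v) \<Rightarrow> ('v \<Rightarrow> 'v) \<Rightarrow> 'k \<Rightarrow> 'v set" where
  "eigenspace scale X \<theta> = {v. X v = scale \<theta> v}"

definition eigenvalues :: "('k::field \<Rightarrow> 'v::ab_group_add \<Rightarrow> 'v) \<Rightarrow> ('v \<Rightarrow> 'v) \<Rightarrow> 'k set" where
  "eigenvalues scale X = {\<theta>. \<exists>v\<in>eigenspace scale X \<theta>. v \<noteq> 0}"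

text \<open>
  Throughout, \<open>d\<close> is the diameter: the underlying space has dimension \<open>d + 1\<close>. Sequences
  indexed by \<open>0, \<dots>, d\<close> are functions on \<open>nat\<close> of which only the values on \<open>{..d}\<close> matter.
  The zero endomorphism is written \<open>\<lambda>_. 0\<close> and the product of endomorphisms is composition.
\<close>

definition orthogonal_idempotents ::
  "('k::field \<Rightarrow> 'v::ab_group_add \<Rightarrow> 'v) \<Rightarrow> nat \<Rightarrow> (nat \<Rightarrow> 'v \<Rightarrow> 'v) \<Rightarrow> bool" where
  "orthogonal_idempotents scale d E \<longleftrightarrow>
     (\<forall>i\<le>d. E i \<in> End scale \<and> map_rank scale (E i) = 1) \<and>
     (\<forall>i\<le>d. \<forall>j\<le>d. E i \<circ> E j = (if i = j then E i else (\<lambda>_. 0)))"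

definition multiplicity_free ::
  "('k::field \<Rightarrow> 'v::ab_group_add \<Rightarrow> 'v) \<Rightarrow> nat \<Rightarrow> ('v \<Rightarrow> 'v) \<Rightarrow> bool" where
  "multiplicity_free scale d X \<longleftrightarrow> X \<in> End scale \<and> card (eigenvalues scale X) = d + 1"

definition primitive_idempotent_for ::
  "('k::field \<Rightarrow> 'v::ab_group_add \<Rightarrow> 'v) \<Rightarrow> ('v \<Rightarrow> 'v) \<Rightarrow> 'k \<Rightarrow> ('v \<Rightarrow> 'v) \<Rightarrow> bool" where
  "primitive_idempotent_for scale X \<theta> P \<longleftrightarrow> P \<in> End scale \<and>
     (\<forall>v\<in>eigenspace scale X \<theta>. P v = v) \<and>
     (\<forall>\<eta>\<in>eigenvalues scale X - {\<theta>}. \<forall>v\<in>eigenspace scale X \<eta>. P v = 0)"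

definition primitive_idempotents ::
  "('k::field \<Rightarrow> 'v::ab_group_add \<Rightarrow> 'v) \<Rightarrow> ('v \<Rightarrow> 'v) \<Rightarrow> ('v \<Rightarrow> 'v) set" where
  "primitive_idempotents scale X =
     {P. \<exists>\<theta>\<in>eigenvalues scale X. primitive_idempotent_for scale X \<theta> P}"

definition primitive_idempotent_ordering ::
  "('k::field \<Rightarrow> 'v::ab_group_add \<Rightarrow> 'v) \<Rightarrow> nat \<Rightarrow> ('v \<Rightarrow> 'v) \<Rightarrow> (nat \<Rightarrow> 'v \<Rightarrow> 'v) \<Rightarrow> bool" where
  "primitive_idempotent_ordering scale d X E \<longleftrightarrow>
     bij_betw E {..d} (primitive_idempotents scale X)"

definition irreducible_tridiagonal ::
  "nat \<Rightarrow> (nat \<Rightarrow> 'v::ab_group_add \<Rightarrow> 'v) \<Rightarrow> ('v \<Rightarrow> 'v) \<Rightarrow> bool" where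
  "irreducible_tridiagonal d E X \<longleftrightarrow>
     (\<forall>i\<le>d. \<forall>j\<le>d.
        (\<bar>int i - int j\<bar> > 1 \<longrightarrow> E i \<circ> X \<circ> E j = (\<lambda>_. 0)) \<and>
        (\<bar>int i - int j\<bar> = 1 \<longrightarrow> E i \<circ> X \<circ> E j \<noteq> (\<lambda>_. 0)))"

definition Leonard_system ::
  "('k::field \<Rightarrow> 'v::ab_group_add \<Rightarrow> 'v) \<Rightarrow> nat \<Rightarrow>
   ('v \<Rightarrow> 'v) \<Rightarrow> (nat \<Rightarrow> 'v \<Rightarrow> 'v) \<Rightarrow> ('v \<Rightarrow> 'v) \<Rightarrow> (nat \<Rightarrow> 'v \<Rightarrow> 'v) \<Rightarrow> bool" where
  "Leonard_system scale d A E Astar Estar \<longleftrightarrow>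
     multiplicity_free scale d A \<and> multiplicity_free scale d Astar \<and>
     primitive_idempotent_ordering scale d A E \<and>
     primitive_idempotent_ordering scale d Astar Estar \<and>
     irreducible_tridiagonal d Estar A \<and>
     irreducible_tridiagonal d E Astar"

definition Q_polynomial_ordering ::
  "('k::field \<Rightarrow> 'v::ab_group_add \<Rightarrow> 'v) \<Rightarrow> nat \<Rightarrow>
   ('v \<Rightarrow> 'v) \<Rightarrow> ('v \<Rightarrow> 'v) \<Rightarrow> (nat \<Rightarrow> 'v \<Rightarrow> 'v) \<Rightarrow> (nat \<Rightarrow> 'v \<Rightarrow> 'v) \<Rightarrow> bool" where
  "Q_polynomial_ordering scale d A Astar Estar E' \<longleftrightarrow>
     primitive_idempotent_ordering scale d A E' \<and> Leonard_system scale d A E' Astar Estar"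

definition Q_polynomial_pair ::
  "('k::field \<Rightarrow> 'v::ab_group_add \<Rightarrow> 'v) \<Rightarrow> nat \<Rightarrow>
   ('v \<Rightarrow> 'v) \<Rightarrow> ('v \<Rightarrow> 'v) \<Rightarrow> (nat \<Rightarrow> 'v \<Rightarrow> 'v) \<Rightarrow> ('v \<Rightarrow> 'v) \<times> ('v \<Rightarrow> 'v) \<Rightarrow> bool" where
  "Q_polynomial_pair scale d A Astar Estar = (\<lambda>(P, Q).
     \<exists>E'. Q_polynomial_ordering scale d A Astar Estar E' \<and> P = E' 0 \<and> Q = E' 1)"

text \<open>
  Adjacency in the graph \<open>\<Delta>\<close> on \<open>{..d}\<close>. The relation is symmetric under the hypotheses of
  the theorem; symmetry is not built into the definition.
\<close>

definition \<Delta>_adjacent ::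
  "nat \<Rightarrow> (nat \<Rightarrow> 'v::ab_group_add \<Rightarrow> 'v) \<Rightarrow> ('v \<Rightarrow> 'v) \<Rightarrow> nat \<Rightarrow> nat \<Rightarrow> bool" where
  "\<Delta>_adjacent d E Astar i j \<longleftrightarrow>
     i \<le> d \<and> j \<le> d \<and> i \<noteq> j \<and> E i \<circ> Astar \<circ> E j \<noteq> (\<lambda>_. 0)"

definition tail ::
  "nat \<Rightarrow> (nat \<Rightarrow> 'v::ab_group_add \<Rightarrow> 'v) \<Rightarrow> ('v \<Rightarrow> 'v) \<Rightarrow> ('v \<Rightarrow> 'v) \<times> ('v \<Rightarrow> 'v) \<Rightarrow> bool" where
  "tail d E Astar = (\<lambda>(P, Q).
     \<exists>i\<le>d. \<exists>j\<le>d. i \<noteq> j \<and> P = E i \<and> Q = E j \<and>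
       (\<forall>k. \<Delta>_adjacent d E Astar i k \<longrightarrow> k = j) \<and>
       card {k. \<Delta>_adjacent d E Astar j k \<and> k \<noteq> i} \<le> 1)"

end

theory Submission
  imports Defs
begin

text \<open>
  The proof compares two bases. Let \<open>v i\<close> span the image of \<open>Estar i\<close> and let \<open>w i\<close> span the
  eigenspace of \<open>A\<close> that belongs to \<open>E i\<close>. In the first basis \<open>A\<close> is irreducible tridiagonal
  and \<open>Astar\<close> is diagonal with entries \<open>\<theta>star i\<close>; in the second \<open>A\<close> is diagonal with distinct
  entries \<open>\<theta> i\<close>, and the nonzero off-diagonal entries of the matrix \<open>s\<close> of \<open>Astar\<close> are the
  edges of \<open>\<Delta>\<close>. An irreducible tridiagonal matrix is self-adjoint for a nondegenerate diagonal
  bilinear form, so \<open>\<Delta>\<close> is symmetric (\<open>s_zero_symmetric\<close>). An ordering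
  of the \<open>E i\<close> is \<open>Q\<close>-polynomial exactly if it lists \<open>\<Delta>\<close> as a path and the scalars
  \<open>\<theta>star i\<close> are distinct.

  Suppose (i)--(iii). By (iii), \<open>Estar 0\<close> is a polynomial in \<open>Astar\<close>; hence a nonzero subspace
  invariant under \<open>A\<close> and \<open>Astar\<close> contains \<open>v 0\<close>, which generates everything under \<open>A\<close>. So
  \<open>\<Delta>\<close> is connected (\<open>graph_connected\<close>). The recurrence (ii) integrates to a quadratic relation
  between consecutive \<open>\<theta>star i\<close>, and that relation says that the operator \<open>\<Phi>\<close>, a combination of
  \<open>Astar\<^sup>2 A\<close>, \<open>Astar A Astar\<close>, \<open>A Astar\<^sup>2\<close>, \<open>A Astar + Astar A\<close> and \<open>A\<close>, has no off-diagonal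
  entries in the basis \<open>v\<close>. Therefore \<open>\<Phi>\<close> commutes with \<open>Astar\<close> (\<open>\<Phi>_commutes_As\<close>). Let
  \<open>P = E (p 0)\<close> and \<open>Q = E (p 1)\<close>. If \<open>d \<ge> 2\<close>, then (i) places \<open>\<Phi> (w (p 0))\<close> in the
  span of \<open>w (p 0)\<close> and its first two images under \<open>Astar\<close>, say
  \<open>\<Phi> = \<alpha> Astar\<^sup>2 + \<omega> Astar + \<eta>\<close> at \<open>w (p 0)\<close> (\<open>\<Phi>_on_tail\<close>). Commutation with \<open>Astar\<close>
  transports this identity along the part \<open>p 0, \<dots>, p n\<close> of the path already found. At
  \<open>w (p (n - 1))\<close>, the coefficient of \<open>w m\<close>, for a neighbour \<open>m\<close> of \<open>p n\<close> off the path,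
  gives \<open>\<theta> m = \<beta> \<theta> (p n) - \<theta> (p (n - 1)) + \<alpha>\<close> (\<open>next_neighbour_unique\<close>). As the \<open>\<theta> i\<close> are
  distinct, there is at most one such \<open>m\<close>; as \<open>\<Delta>\<close> is connected, there is one until all vertices
  are used (\<open>path_of_tail\<close>). Finally, \<open>w (p 0)\<close> is a cyclic vector for \<open>Astar\<close>, so the
  eigenvalues \<open>\<theta>star i\<close> are distinct (\<open>full_path_eigenvalues_distinct\<close>).

  Conversely, in a Leonard system (i) and (iii) can be read off. For (ii), the tridiagonal shape of
  \<open>s\<close> yields an operator \<open>Z\<close> that commutes with \<open>A\<close> and satisfies
  \<open>A\<^sup>2 Astar A - A Astar A\<^sup>2 = Z Astar - Astar Z\<close>. In the basis \<open>v\<close> this identity bounds the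
  bandwidth of \<open>Z\<close> by three, and commutation with \<open>A\<close> makes the third superdiagonal of \<open>Z\<close> a
  constant multiple \<open>q\<close> of that of \<open>A\<^sup>3\<close>. Comparing third superdiagonals,
  \<open>q (\<theta>star (i + 3) - \<theta>star i) = \<theta>star (i + 2) - \<theta>star (i + 1)\<close> for all \<open>i\<close>, which is the
  recurrence with \<open>\<beta> = 1 / q - 1\<close> (\<open>recurrence_of_tridiagonal_dual\<close>).
\<close>

section \<open>Coordinates with respect to rank-one projections\<close>

lemma sum_eq_single_term:
  assumes "finite S" "k \<in> S" "\<And>j. j \<in> S \<Longrightarrow> j \<noteq> k \<Longrightarrow> f j = 0"
  shows "sum f S = (f k :: 'a::comm_monoid_add)"
proof -
  have "sum f S = sum f {k}"
    using assms by (intro sum.mono_neutral_right) auto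
  then show ?thesis by simp
qed

text \<open>
  A basis \<open>v 0, \<dots>, v d\<close> together with its coordinate functionals. This is the form in which both
  families of rank-one idempotents are used: an idempotent of such a family is
  \<open>x \<mapsto> scale (c i x) (v i)\<close>.
\<close>

locale coordinates = vector_space scale
  for scale :: "'k::field \<Rightarrow> 'v::ab_group_add \<Rightarrow> 'v" +
  fixes d :: nat and v :: "nat \<Rightarrow> 'v" and c :: "nat \<Rightarrow> 'v \<Rightarrow> 'k"
  assumes coord_linear: "Vector_Spaces.linear scale (*) (c i)"
    and coord_basis: "i \<le> d \<Longrightarrow> j \<le> d \<Longrightarrow> c i (v j) = (if i = j then 1 else 0)"
    and expansion: "x = (\<Sum>i\<le>d. scale (c i x) (v i))"
begin

lemma coord_add: "c i (x + y) = c i x + c i y"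
  using coord_linear[of i] by (simp add: Vector_Spaces.linear_iff)

lemma coord_scale: "c i (scale a x) = a * c i x"
  using coord_linear[of i] by (simp add: Vector_Spaces.linear_iff)

lemma coord_zero: "c i 0 = 0"
  using coord_scale[of i 0 0] by simp

lemma coord_diff: "c i (x - y) = c i x - c i y"
  using coord_add[of i "x - y" y] by simp

lemma coord_sum: "c i (\<Sum>j\<in>S. f j) = (\<Sum>j\<in>S. c i (f j))"
  by (induction S rule: infinite_finite_induct) (simp_all add: coord_zero coord_add)

lemmas coord_simps = coord_add coord_scale coord_zero coord_diff coord_sum

lemma coord_eqI: "(\<And>i. i \<le> d \<Longrightarrow> c i x = c i y) \<Longrightarrow> x = y"
  using expansion[of x] expansion[of y] by simp

lemma basis_nonzero: "i \<le> d \<Longrightarrow> v i \<noteq> 0"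
  using coord_basis[of i i] by (auto simp: coord_zero)

lemma coord_of_image:
  assumes "Vector_Spaces.linear scale scale X"
  shows "c i (X x) = (\<Sum>j\<le>d. c i (X (v j)) * c j x)"
proof -
  interpret X: Vector_Spaces.linear scale scale X by fact
  have "X x = X (\<Sum>j\<le>d. scale (c j x) (v j))" using expansion[of x] by simp
  also have "c i \<dots> = (\<Sum>j\<le>d. c i (X (v j)) * c j x)"
    by (simp add: X.sum X.scale coord_sum coord_scale mult.commute)
  finally show ?thesis .
qed

lemma linear_eqI:
  assumes "Vector_Spaces.linear scale scale X" "Vector_Spaces.linear scale scale Y"
    and "\<And>j. j \<le> d \<Longrightarrow> X (v j) = Y (v j)"
  shows "X = Y"
proof
  fix x
  show "X x = Y x"
    using assms by (intro coord_eqI) (simp add: coord_of_image)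
qed

text \<open>
  This turns the conditions on \<open>Estar i \<circ> A \<circ> Estar j\<close> and \<open>E i \<circ> Astar \<circ> E j\<close> into conditions
  on matrix entries.
\<close>

lemma projections_sandwich_zero_iff:
  assumes F: "\<And>k x. k \<le> d \<Longrightarrow> F k x = scale (c k x) (v k)"
    and X: "Vector_Spaces.linear scale scale X" and "i \<le> d" "j \<le> d"
  shows "F i \<circ> X \<circ> F j = (\<lambda>_. 0) \<longleftrightarrow> c i (X (v j)) = 0"
proof -
  interpret X: Vector_Spaces.linear scale scale X by fact
  have eq: "(F i \<circ> X \<circ> F j) x = scale (c j x * c i (X (v j))) (v i)" for x
    using assms(3,4) by (simp add: F X.scale coord_scale)
  show ?thesis
  proof
    assume "F i \<circ> X \<circ> F j = (\<lambda>_. 0)"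
    then have "scale (c j (v j) * c i (X (v j))) (v i) = 0"
      using eq[of "v j"] by simp
    then show "c i (X (v j)) = 0"
      using assms(3,4) basis_nonzero[of i] by (simp add: coord_basis)
  qed (use eq in auto)
qed

end

text \<open>
  Applying \<open>F i\<close> to a linear relation among the \<open>w j\<close> isolates the coefficient of \<open>w i\<close>, so
  the \<open>d + 1\<close> vectors \<open>w j\<close> are independent and, by dimension, form a basis.
\<close>

lemma coordinates_of_projections:
  fixes scale :: "'k::field \<Rightarrow> 'v::ab_group_add \<Rightarrow> 'v"
  assumes "vector_space scale"
    and dim: "vector_space.dim scale (UNIV :: 'v set) = d + 1"
    and lin: "\<And>i. i \<le> d \<Longrightarrow> Vector_Spaces.linear scale scale (F i)"
    and nz: "\<And>i. i \<le> d \<Longrightarrow> w i \<noteq> 0"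
    and proj: "\<And>i j. i \<le> d \<Longrightarrow> j \<le> d \<Longrightarrow> F i (w j) = (if i = j then w i else 0)"
  obtains c where "coordinates scale d w c"
    and "\<And>i x. i \<le> d \<Longrightarrow> F i x = scale (c i x) (w i)"
proof -
  interpret vector_space scale by fact
  let ?W = "w ` {..d}"
  have inj: "inj_on w {..d}"
    by (rule inj_onI) (metis atMost_iff nz proj)
  have ind: "independent ?W"
  proof (subst dependent_finite)
    show "\<not> (\<exists>u. (\<exists>y\<in>?W. u y \<noteq> 0) \<and> (\<Sum>y\<in>?W. scale (u y) y) = 0)"
    proof (rule notI, elim exE conjE bexE)
      fix u y assume y: "y \<in> ?W" "u y \<noteq> 0" and 0: "(\<Sum>y\<in>?W. scale (u y) y) = 0"
      obtain i where i: "i \<le> d" "y = w i" using y by auto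
      interpret Fi: Vector_Spaces.linear scale scale "F i" using lin i by blast
      have "0 = F i (\<Sum>j\<le>d. scale (u (w j)) (w j))"
        using 0 inj by (simp add: sum.reindex)
      also have "\<dots> = (\<Sum>j\<le>d. scale (u (w j)) (F i (w j)))"
        by (simp add: Fi.sum Fi.scale)
      also have "\<dots> = scale (u (w i)) (F i (w i))"
        by (rule sum_eq_single_term) (use i proj in auto)
      finally show False using i y nz proj by auto
    qed
  qed simp
  have card: "card ?W = d + 1" using inj by (simp add: card_image)
  have span: "span ?W = UNIV"
  proof -
    obtain B where B: "independent B" "span B = UNIV" "card B = d + 1"
      using basis_exists[of UNIV] dim by (metis top.extremum_uniqueI)
    have "finite B" using B(3) by (metis add_is_0 card.infinite one_neq_zero)
    have *: "y \<in> span ?W" for y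
    proof (rule ccontr)
      assume y: "y \<notin> span ?W"
      have "independent (insert y ?W)" using y ind by (simp add: independent_insert span_base)
      moreover have "card (insert y ?W) = d + 2"
        using y card span_base[of y ?W] by (subst card_insert_disjoint) auto
      ultimately show False
        using independent_span_bound[of B "insert y ?W"] B \<open>finite B\<close> by auto
    qed
    then show ?thesis by auto
  qed
  define c where "c = (\<lambda>i x. representation ?W x (w i))"
  have c: "coordinates scale d w c"
  proof (intro coordinates.intro coordinates_axioms.intro vector_space_axioms)
    show "Vector_Spaces.linear scale (*) (c i)" for i
      unfolding c_def by (rule linear_representation) (use ind span in auto)
    show "c i (w j) = (if i = j then 1 else 0)" if "i \<le> d" "j \<le> d" for i j
      using that inj unfolding c_def
      by (subst representation_basis[OF ind]) (auto dest: inj_onD)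
    show "x = (\<Sum>i\<le>d. scale (c i x) (w i))" for x
      using sum_representation_eq[OF ind, of x ?W] span inj
      by (simp add: c_def sum.reindex)
  qed
  then interpret coordinates scale d w c .
  show ?thesis
  proof (rule that[OF c])
    fix i x assume i: "i \<le> d"
    interpret Fi: Vector_Spaces.linear scale scale "F i" using lin i by blast
    have "F i x = F i (\<Sum>j\<le>d. scale (c j x) (w j))" using expansion[of x] by simp
    also have "\<dots> = (\<Sum>j\<le>d. scale (c j x) (F i (w j)))" by (simp add: Fi.sum Fi.scale)
    also have "\<dots> = scale (c i x) (F i (w i))"
      by (rule sum_eq_single_term) (use i proj in auto)
    finally show "F i x = scale (c i x) (w i)" using i proj by simp
  qed
qed

text \<open>
  Rank one supplies a nonzero vector fixed by each idempotent.
\<close>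

lemma coordinates_of_orthogonal_idempotents:
  assumes "vector_space scale" "vector_space.dim scale (UNIV :: 'v::ab_group_add set) = d + 1"
    and orth: "orthogonal_idempotents (scale :: 'k::field \<Rightarrow> 'v \<Rightarrow> 'v) d F"
  obtains v c where "coordinates scale d v c"
    and "\<And>i x. i \<le> d \<Longrightarrow> F i x = scale (c i x) (v i)"
proof -
  interpret vector_space scale by fact
  have lin: "Vector_Spaces.linear scale scale (F i)" if "i \<le> d" for i
    using that orth by (auto simp: orthogonal_idempotents_def End_def)
  have comp: "F i (F j x) = (if i = j then F i x else 0)" if "i \<le> d" "j \<le> d" for i j x
    using that orth unfolding orthogonal_idempotents_def by (metis comp_apply)
  have "\<exists>y. y \<noteq> 0 \<and> F i y = y" if i: "i \<le> d" for i
  proof (rule ccontr)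
    assume *: "\<nexists>y. y \<noteq> 0 \<and> F i y = y"
    have "F i x = 0" for x using * comp[OF i i, of x] by auto
    then have "range (F i) \<subseteq> span {}" by auto
    then have "dim (range (F i)) \<le> card ({}::'v set)" by (rule dim_le_card) simp
    moreover have "dim (range (F i)) = 1"
      using orth i by (auto simp: orthogonal_idempotents_def map_rank_def)
    ultimately show False by simp
  qed
  then obtain v where v: "\<And>i. i \<le> d \<Longrightarrow> v i \<noteq> 0 \<and> F i (v i) = v i" by metis
  have proj: "F i (v j) = (if i = j then v i else 0)" if "i \<le> d" "j \<le> d" for i j
    using comp[OF that, of "v j"] v that by metis
  show ?thesis
    by (rule coordinates_of_projections[OF assms(1,2) lin _ proj])
      (use v that in auto)
qed

text \<open>
  The operator \<open>G\<close> is the polynomial \<open>\<Prod>s\<in>S. (X - s)\<close> in \<open>X\<close>. With \<open>S\<close> all eigenvalues but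
  one it is, up to a scalar, the projection onto the remaining eigenspace.
\<close>

lemma polynomial_operator_exists:
  assumes "vector_space scale" and X: "Vector_Spaces.linear scale scale X" and "finite S"
  shows "\<exists>G. Vector_Spaces.linear scale scale G \<and>
    (\<forall>\<eta>. \<forall>u\<in>eigenspace scale X \<eta>. G u = scale (\<Prod>s\<in>S. \<eta> - s) u)"
  using \<open>finite S\<close>
proof induction
  case empty
  interpret vector_space scale by fact
  show ?case by (rule exI[of _ "\<lambda>x. x"]) (simp add: Vector_Spaces.linear_iff vector_space_axioms)
next
  case (insert t S)
  interpret vector_space scale by fact
  interpret X: Vector_Spaces.linear scale scale X by fact
  obtain G where G: "Vector_Spaces.linear scale scale G"
    "\<And>\<eta> u. u \<in> eigenspace scale X \<eta> \<Longrightarrow> G u = scale (\<Prod>s\<in>S. \<eta> - s) u"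
    using insert.IH by auto
  interpret G: Vector_Spaces.linear scale scale G by fact
  show ?case
  proof (intro exI[of _ "\<lambda>x. X (G x) - scale t (G x)"] conjI allI ballI)
    show "Vector_Spaces.linear scale scale (\<lambda>x. X (G x) - scale t (G x))"
      by (simp add: Vector_Spaces.linear_iff vector_space_axioms G.add G.scale X.add X.scale algebra_simps)
    fix \<eta> u assume u: "u \<in> eigenspace scale X \<eta>"
    have "X u = scale \<eta> u" using u by (simp add: eigenspace_def)
    then show "X (G u) - scale t (G u) = scale (\<Prod>s\<in>insert t S. \<eta> - s) u"
      using insert.hyps G(2)[OF u] by (simp add: X.scale algebra_simps)
  qed
qed

lemma eigenvector_coordinates:
  assumes vs: "vector_space scale" and dim: "vector_space.dim scale (UNIV :: 'v::ab_group_add set) = d + 1"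
    and mf: "multiplicity_free (scale :: 'k::field \<Rightarrow> 'v \<Rightarrow> 'v) d X"
    and bij: "bij_betw \<eta> {..d} (eigenvalues scale X)"
  obtains u c where "coordinates scale d u c"
    and "\<And>i. i \<le> d \<Longrightarrow> u i \<in> eigenspace scale X (\<eta> i)"
proof -
  interpret vector_space scale by fact
  have X: "Vector_Spaces.linear scale scale X" using mf by (simp add: multiplicity_free_def End_def)
  have "\<exists>u. u \<in> eigenspace scale X (\<eta> i) \<and> u \<noteq> 0" if "i \<le> d" for i
    using bij_betwE[OF bij] that by (auto simp: eigenvalues_def)
  then obtain u where u: "\<And>i. i \<le> d \<Longrightarrow> u i \<in> eigenspace scale X (\<eta> i) \<and> u i \<noteq> 0" by metis
  have inj: "\<eta> i = \<eta> j \<longleftrightarrow> i = j" if "i \<le> d" "j \<le> d" for i j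
    using that bij by (auto simp: bij_betw_def dest: inj_onD)
  define p where "p i = (\<Prod>s\<in>\<eta> ` ({..d} - {i}). \<eta> i - s)" for i
  have "\<exists>G. Vector_Spaces.linear scale scale G \<and>
    (\<forall>\<theta>. \<forall>u\<in>eigenspace scale X \<theta>. G u = scale (\<Prod>s\<in>\<eta> ` ({..d} - {i}). \<theta> - s) u)" for i
    by (rule polynomial_operator_exists[OF vs X]) simp
  then obtain G where G: "\<And>i. Vector_Spaces.linear scale scale (G i)"
    "\<And>i \<theta> u. u\<in>eigenspace scale X \<theta> \<Longrightarrow> G i u = scale (\<Prod>s\<in>\<eta> ` ({..d} - {i}). \<theta> - s) u"
    by metis
  have p: "p i \<noteq> 0" if "i \<le> d" for i
    using inj that by (auto simp: p_def)
  have Gu: "G i (u j) = (if i = j then scale (p i) (u i) else 0)" if "i \<le> d" "j \<le> d" for i j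
  proof (cases "i = j")
    case False
    then have "(\<Prod>s\<in>\<eta> ` ({..d} - {i}). \<eta> j - s) = 0"
      using that by (intro prod_zero) auto
    then show ?thesis using G(2)[of "u j" "\<eta> j" i] u that False by simp
  qed (use G(2) u that p_def in auto)
  let ?F = "\<lambda>i x. scale (inverse (p i)) (G i x)"
  show ?thesis
  proof (rule coordinates_of_projections[OF vs dim, of ?F u])
    show "Vector_Spaces.linear scale scale (?F i)" for i
      using G(1)[of i] by (simp add: Vector_Spaces.linear_iff algebra_simps)
  qed (use u Gu p that in auto)
qed

text \<open>
  The definition prescribes a primitive idempotent on eigenvectors only; these form a basis because
  there are \<open>d + 1\<close> distinct eigenvalues.
\<close>

lemma primitive_idempotent_unique:
  assumes vs: "vector_space scale" and dim: "vector_space.dim scale (UNIV :: 'v::ab_group_add set) = d + 1"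
    and mf: "multiplicity_free (scale :: 'k::field \<Rightarrow> 'v \<Rightarrow> 'v) d X"
    and P: "primitive_idempotent_for scale X \<theta> P" and Q: "primitive_idempotent_for scale X \<theta> Q"
  shows "P = Q"
proof -
  have "card (eigenvalues scale X) = d + 1" using mf by (simp add: multiplicity_free_def)
  then have "finite (eigenvalues scale X)" by (metis add_is_0 card.infinite one_neq_zero)
  then obtain \<eta> where "bij_betw \<eta> {0..<d+1} (eigenvalues scale X)"
    using ex_bij_betw_nat_finite \<open>card _ = _\<close> by metis
  then have \<eta>: "bij_betw \<eta> {..d} (eigenvalues scale X)"
    by (simp add: atLeast0LessThan lessThan_Suc_atMost)
  obtain u c where "coordinates scale d u c"
    and u: "\<And>i. i \<le> d \<Longrightarrow> u i \<in> eigenspace scale X (\<eta> i)"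
    using eigenvector_coordinates[OF vs dim mf \<eta>] by metis
  interpret coordinates scale d u c by fact
  show ?thesis
  proof (rule linear_eqI)
    fix j assume j: "j \<le> d"
    have "\<eta> j \<in> eigenvalues scale X" using j \<eta> by (auto simp: bij_betw_def)
    then show "P (u j) = Q (u j)"
      using P Q u[OF j] by (cases "\<eta> j = \<theta>") (auto simp: primitive_idempotent_for_def)
  qed (use P Q in \<open>auto simp: primitive_idempotent_for_def End_def\<close>)
qed

lemma coordinates_of_primitive_idempotents:
  assumes vs: "vector_space scale" and dim: "vector_space.dim scale (UNIV :: 'v::ab_group_add set) = d + 1"
    and mf: "multiplicity_free (scale :: 'k::field \<Rightarrow> 'v \<Rightarrow> 'v) d X"
    and ord: "primitive_idempotent_ordering scale d X E"
  obtains w e \<theta> where "coordinates scale d w e"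
    and "\<And>i x. i \<le> d \<Longrightarrow> E i x = scale (e i x) (w i)"
    and "\<And>i. i \<le> d \<Longrightarrow> X (w i) = scale (\<theta> i) (w i)"
    and "inj_on \<theta> {..d}"
proof -
  interpret vector_space scale by fact
  have bij: "bij_betw E {..d} (primitive_idempotents scale X)"
    using ord by (simp add: primitive_idempotent_ordering_def)
  have "\<exists>\<theta>. \<theta> \<in> eigenvalues scale X \<and> primitive_idempotent_for scale X \<theta> (E i)" if "i \<le> d" for i
    using bij_betwE[OF bij] that by (auto simp: primitive_idempotents_def)
  then obtain \<theta> where \<theta>: "\<And>i. i \<le> d \<Longrightarrow> \<theta> i \<in> eigenvalues scale X"
    "\<And>i. i \<le> d \<Longrightarrow> primitive_idempotent_for scale X (\<theta> i) (E i)" by metis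
  have inj: "inj_on \<theta> {..d}"
  proof (rule inj_onI)
    fix i j assume ij: "i \<in> {..d}" "j \<in> {..d}" "\<theta> i = \<theta> j"
    then have "E i = E j"
      using primitive_idempotent_unique[OF vs dim mf, of "\<theta> i" "E i" "E j"] \<theta>(2)[of i] \<theta>(2)[of j]
      by auto
    then show "i = j" using bij ij by (auto simp: bij_betw_def dest: inj_onD)
  qed
  have "\<exists>u. u \<noteq> 0 \<and> X u = scale (\<theta> i) u" if "i \<le> d" for i
    using \<theta>(1)[OF that] by (auto simp: eigenvalues_def eigenspace_def)
  then obtain w where w: "\<And>i. i \<le> d \<Longrightarrow> w i \<noteq> 0 \<and> X (w i) = scale (\<theta> i) (w i)" by metis
  have proj: "E i (w j) = (if i = j then w i else 0)" if "i \<le> d" "j \<le> d" for i j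
  proof -
    have "\<theta> j \<in> eigenvalues scale X - {\<theta> i}" if "i \<noteq> j"
      using \<theta>(1) \<open>i \<le> d\<close> \<open>j \<le> d\<close> inj that by (auto dest: inj_onD)
    then show ?thesis
      using \<theta>(2)[OF that(1)] w[OF that(2)] by (auto simp: primitive_idempotent_for_def eigenspace_def)
  qed
  have lin: "Vector_Spaces.linear scale scale (E i)" if "i \<le> d" for i
    using \<theta>(2)[OF that] by (simp add: primitive_idempotent_for_def End_def)
  obtain e where e: "coordinates scale d w e" "\<And>i x. i \<le> d \<Longrightarrow> E i x = scale (e i x) (w i)"
    using coordinates_of_projections[OF vs dim lin _ proj] w by metis
  show ?thesis by (rule that[OF e _ inj]) (use w in auto)
qed

lemma (in coordinates) coord_of_diagonal_image:
  assumes "Vector_Spaces.linear scale scale X"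
    and "\<And>j. j \<le> d \<Longrightarrow> X (v j) = scale (f j) (v j)" and "i \<le> d"
  shows "c i (X x) = f i * c i x"
proof -
  have "c i (X x) = (\<Sum>j\<le>d. c i (X (v j)) * c j x)" by (rule coord_of_image) fact
  also have "\<dots> = c i (X (v i)) * c i x"
    by (rule sum_eq_single_term) (use assms coord_basis in \<open>auto simp: coord_scale\<close>)
  finally show ?thesis using assms coord_basis by (simp add: coord_scale)
qed

text \<open>
  The basis vectors are listed by an injective \<open>\<pi>\<close> so that the expansion can be taken along a path
  in \<open>\<Delta>\<close>.
\<close>

lemma (in coordinates) expansion_along:
  assumes "inj_on \<pi> {..n}" "\<pi> ` {..n} \<subseteq> {..d}"
    and "\<And>m. m \<le> d \<Longrightarrow> m \<notin> \<pi> ` {..n} \<Longrightarrow> c m y = 0"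
  shows "y = (\<Sum>l\<le>n. scale (c (\<pi> l) y) (v (\<pi> l)))"
proof -
  have "y = (\<Sum>i\<le>d. scale (c i y) (v i))" by (rule expansion)
  also have "\<dots> = (\<Sum>i\<in>\<pi> ` {..n}. scale (c i y) (v i))"
    using assms(2,3) by (intro sum.mono_neutral_right) auto
  also have "\<dots> = (\<Sum>l\<le>n. scale (c (\<pi> l) y) (v (\<pi> l)))"
    using assms(1) by (simp add: sum.reindex)
  finally show ?thesis .
qed

lemma (in coordinates) eigenvalues_of_diagonal:
  assumes X: "Vector_Spaces.linear scale scale X" "\<And>j. j \<le> d \<Longrightarrow> X (v j) = scale (f j) (v j)"
  shows "eigenvalues scale X = f ` {..d}"
proof (intro equalityI subsetI)
  fix \<eta> assume "\<eta> \<in> eigenvalues scale X"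
  then obtain x where x: "X x = scale \<eta> x" "x \<noteq> 0" by (auto simp: eigenvalues_def eigenspace_def)
  obtain i where i: "i \<le> d" "c i x \<noteq> 0" using coord_eqI[of x 0] x(2) by (auto simp: coord_zero)
  have "c i (X x) = f i * c i x" by (rule coord_of_diagonal_image[OF X i(1)])
  moreover have "c i (X x) = \<eta> * c i x" using x(1) by (simp add: coord_scale)
  ultimately have "\<eta> = f i" using i(2) by simp
  then show "\<eta> \<in> f ` {..d}" using i(1) by simp
next
  fix \<eta> assume "\<eta> \<in> f ` {..d}"
  then show "\<eta> \<in> eigenvalues scale X"
    using X(2) basis_nonzero by (auto simp: eigenvalues_def eigenspace_def)
qed

lemma (in coordinates) primitive_idempotents_of_diagonal:
  assumes X: "Vector_Spaces.linear scale scale X" "\<And>j. j \<le> d \<Longrightarrow> X (v j) = scale (f j) (v j)"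
    and f: "inj_on f {..d}"
    and F: "\<And>i. i \<le> d \<Longrightarrow> Vector_Spaces.linear scale scale (F i)"
      "\<And>i x. i \<le> d \<Longrightarrow> F i x = scale (c i x) (v i)"
  shows "primitive_idempotent_ordering scale d X F"
  unfolding primitive_idempotent_ordering_def bij_betw_def
proof
  have eigs: "eigenvalues scale X = f ` {..d}" by (rule eigenvalues_of_diagonal[OF X])
  show "inj_on F {..d}"
  proof (rule inj_onI)
    fix i j assume ij: "i \<in> {..d}" "j \<in> {..d}" "F i = F j"
    then have "c i (F i (v i)) = c i (F j (v i))" by simp
    then show "i = j" using ij(1,2) F(2) by (auto simp: coord_basis coord_scale split: if_splits)
  qed
  have f_iff: "f i = f j \<longleftrightarrow> i = j" if "i \<le> d" "j \<le> d" for i j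
    using f that by (auto dest: inj_onD)
  have coord_eigenspace: "c j x = 0" if "i \<le> d" "j \<le> d" "i \<noteq> j" "x \<in> eigenspace scale X (f i)" for i j x
  proof -
    have "c j (X x) = f j * c j x" by (rule coord_of_diagonal_image[OF X that(2)])
    moreover have "c j (X x) = f i * c j x" using that(4) by (simp add: eigenspace_def coord_scale)
    ultimately show ?thesis using f_iff that by auto
  qed
  have prim: "primitive_idempotent_for scale X (f i) (F i)" if i: "i \<le> d" for i
    unfolding primitive_idempotent_for_def eigs
  proof (intro conjI ballI)
    show "F i \<in> End scale" using F(1) i by (simp add: End_def)
    show "F i x = x" if x: "x \<in> eigenspace scale X (f i)" for x
    proof (rule coord_eqI)
      fix j assume "j \<le> d"
      then show "c j (F i x) = c j x"
        using coord_eigenspace[OF i _ _ x, of j] i by (cases "i = j") (auto simp: F(2) coord_scale coord_basis)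
    qed
    fix \<eta> x assume "\<eta> \<in> f ` {..d} - {f i}" "x \<in> eigenspace scale X \<eta>"
    then show "F i x = 0" using coord_eigenspace[of _ i x] i by (auto simp: F(2))
  qed
  show "F ` {..d} = primitive_idempotents scale X"
  proof (intro equalityI subsetI)
    fix P assume "P \<in> F ` {..d}"
    then show "P \<in> primitive_idempotents scale X"
      using prim by (auto simp: primitive_idempotents_def eigs)
  next
    fix P assume "P \<in> primitive_idempotents scale X"
    then obtain i where i: "i \<le> d" and P: "primitive_idempotent_for scale X (f i) P"
      by (auto simp: primitive_idempotents_def eigs)
    have "P = F i"
    proof (rule linear_eqI)
      fix j assume j: "j \<le> d"
      have "v j \<in> eigenspace scale X (f j)" using X(2) j by (simp add: eigenspace_def)
      moreover have "j \<noteq> i \<Longrightarrow> f j \<in> eigenvalues scale X - {f i}"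
        using f_iff[OF j i] j eigs by auto
      ultimately show "P (v j) = F i (v j)"
        using P prim[OF i] unfolding primitive_idempotent_for_def by (cases "j = i") auto
    qed (use P F(1) i in \<open>auto simp: primitive_idempotent_for_def End_def\<close>)
    then show "P \<in> F ` {..d}" using i by auto
  qed
qed

section \<open>The two matrices and the graph\<close>

lemma (in vector_space) subspace_cancel:
  assumes "subspace U" "x + scale r y \<in> U" "x \<in> U" "r \<noteq> 0"
  shows "y \<in> U"
proof -
  have "scale (inverse r) (x + scale r y - x) \<in> U"
    using assms by (intro subspace_scale subspace_diff)
  then show ?thesis using assms(4) by simp
qed

text \<open>
  \<open>As\<close> stands for \<open>Astar\<close> and \<open>\<phi>\<close> for \<open>\<theta>star\<close>. The scalars \<open>\<phi> i\<close> may coincide: in a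
  Leonard system they are distinct because \<open>Astar\<close> is multiplicity-free, whereas for a tail their
  distinctness has to be proved.
\<close>

locale tridiagonal_diagonal_pair =
  coordinates scale d v c + eig: coordinates scale d w e
  for scale :: "'k::field \<Rightarrow> 'v::ab_group_add \<Rightarrow> 'v" and d v c w e +
  fixes A As :: "'v \<Rightarrow> 'v" and \<theta> \<phi> :: "nat \<Rightarrow> 'k"
  assumes A_linear: "Vector_Spaces.linear scale scale A"
    and As_linear: "Vector_Spaces.linear scale scale As"
    and A_eigenvector: "i \<le> d \<Longrightarrow> A (w i) = scale (\<theta> i) (w i)"
    and \<theta>_inj: "inj_on \<theta> {..d}"
    and As_eigenvector: "i \<le> d \<Longrightarrow> As (v i) = scale (\<phi> i) (v i)"
    and A_tridiagonal: "i \<le> d \<Longrightarrow> j \<le> d \<Longrightarrow> Suc i < j \<or> Suc j < i \<Longrightarrow> c i (A (v j)) = 0"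
    and A_irreducible: "Suc i \<le> d \<Longrightarrow> c i (A (v (Suc i))) \<noteq> 0 \<and> c (Suc i) (A (v i)) \<noteq> 0"
begin

abbreviation a :: "nat \<Rightarrow> nat \<Rightarrow> 'k" where "a i j \<equiv> c i (A (v j))"

abbreviation s :: "nat \<Rightarrow> nat \<Rightarrow> 'k" where "s i j \<equiv> e i (As (w j))"

sublocale A: Vector_Spaces.linear scale scale A by (rule A_linear)
sublocale As: Vector_Spaces.linear scale scale As by (rule As_linear)

lemma \<theta>_eq_iff: "i \<le> d \<Longrightarrow> j \<le> d \<Longrightarrow> \<theta> i = \<theta> j \<longleftrightarrow> i = j"
  using \<theta>_inj by (auto dest: inj_onD)

lemma c_A: "c i (A x) = (\<Sum>j\<le>d. a i j * c j x)"
  by (rule coord_of_image) (rule A_linear)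

lemma e_A: "i \<le> d \<Longrightarrow> e i (A x) = \<theta> i * e i x"
  by (rule eig.coord_of_diagonal_image) (auto simp: A_linear A_eigenvector)

lemma c_As: "i \<le> d \<Longrightarrow> c i (As x) = \<phi> i * c i x"
  by (rule coord_of_diagonal_image) (auto simp: As_linear As_eigenvector)

lemma e_As: "e i (As x) = (\<Sum>j\<le>d. s i j * e j x)"
  by (rule eig.coord_of_image) (rule As_linear)

text \<open>
  Row \<open>n\<close> of the eigenvalue equation determines the coordinate \<open>n + 1\<close> from the earlier ones, as
  the superdiagonal entry \<open>a n (Suc n)\<close> is nonzero.
\<close>

lemma first_coordinate_nonzero:
  assumes "A x = scale \<eta> x" "x \<noteq> 0"
  shows "c 0 x \<noteq> 0"
proof
  assume 0: "c 0 x = 0"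
  have "\<forall>k\<le>n. c k x = 0" if "n \<le> d" for n
    using that
  proof (induction n)
    case (Suc n)
    have "0 = c n (A x)" using Suc assms(1) by (simp add: coord_scale)
    also have "\<dots> = (\<Sum>j\<le>d. a n j * c j x)" by (rule c_A)
    also have "\<dots> = a n (Suc n) * c (Suc n) x"
    proof (rule sum_eq_single_term)
      fix j assume "j \<in> {..d}" "j \<noteq> Suc n"
      then show "a n j * c j x = 0"
        using Suc A_tridiagonal[of n j] by (cases "j \<le> n") auto
    qed (use Suc in auto)
    finally have "c (Suc n) x = 0" using A_irreducible[of n] Suc.prems by simp
    then show ?case using Suc by (auto simp: le_Suc_eq)
  qed (use 0 in auto)
  then have "x = 0" by (intro coord_eqI) (auto simp: coord_zero)
  with assms show False by simp
qed

text \<open>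
  The weights \<open>\<kappa> i\<close> below make \<open>A\<close> self-adjoint for the form \<open>B\<close>, and any diagonal form makes
  \<open>As\<close> self-adjoint. Eigenvectors of \<open>A\<close> for different eigenvalues are then orthogonal, so
  nondegeneracy of \<open>B\<close> gives \<open>B (w i) (w i) \<noteq> 0\<close>, and
  \<open>s i j * B (w i) (w i) = B (w i) (As (w j))\<close> is symmetric in \<open>i\<close> and \<open>j\<close>.
\<close>

lemma s_zero_symmetric:
  assumes "i \<le> d" "j \<le> d"
  shows "s i j = 0 \<longleftrightarrow> s j i = 0"
proof -
  define \<kappa> where "\<kappa> i = (\<Prod>k<i. a k (Suc k) / a (Suc k) k)" for i
  have \<kappa>_nz: "\<kappa> i \<noteq> 0" if "i \<le> d" for i
    using that A_irreducible by (auto simp: \<kappa>_def)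
  have \<kappa>_Suc: "\<kappa> (Suc i) * a (Suc i) i = \<kappa> i * a i (Suc i)" if "Suc i \<le> d" for i
    using that A_irreducible[of i] by (simp add: \<kappa>_def)
  have \<kappa>: "\<kappa> i * a i j = \<kappa> j * a j i" if "i \<le> d" "j \<le> d" for i j
  proof -
    consider "i = j" | "j = Suc i" | "i = Suc j" | "Suc i < j \<or> Suc j < i" by linarith
    then show ?thesis using that \<kappa>_Suc A_tridiagonal[of i j] A_tridiagonal[of j i] by cases auto
  qed
  define B where "B x y = (\<Sum>i\<le>d. \<kappa> i * c i x * c i y)" for x y
  have B_sym: "B x y = B y x" for x y by (simp add: B_def mult_ac)
  have B_scale: "B x (scale r y) = r * B x y" for x r y
    by (simp add: B_def coord_scale sum_distrib_left mult_ac)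
  have B_scale': "B (scale r x) y = r * B x y" for x r y using B_sym B_scale by metis
  have B_zero: "B x 0 = 0" for x by (simp add: B_def coord_zero)
  have B_add: "B x (y + z) = B x y + B x z" for x y z
    by (simp add: B_def coord_add sum.distrib distrib_left)
  have B_sum: "B x (\<Sum>j\<in>S. f j) = (\<Sum>j\<in>S. B x (f j))" for x f and S :: "nat set"
    by (induction S rule: infinite_finite_induct) (simp_all add: B_zero B_add)
  have B_A: "B (A x) y = B x (A y)" for x y
  proof -
    have "B (A x) y = (\<Sum>i\<le>d. \<Sum>j\<le>d. \<kappa> i * a i j * c j x * c i y)"
      by (simp add: B_def c_A[of _ x] sum_distrib_left sum_distrib_right mult_ac)
    also have "\<dots> = (\<Sum>i\<le>d. \<Sum>j\<le>d. \<kappa> j * a j i * c j x * c i y)"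
      by (intro sum.cong refl) (simp add: \<kappa>)
    also have "\<dots> = (\<Sum>j\<le>d. \<Sum>i\<le>d. \<kappa> j * a j i * c j x * c i y)" by (rule sum.swap)
    also have "\<dots> = B x (A y)"
      by (simp add: B_def c_A[of _ y] sum_distrib_left sum_distrib_right mult_ac)
    finally show ?thesis .
  qed
  have B_As: "B (As x) y = B x (As y)" for x y
    by (simp add: B_def c_As mult_ac)
  have B_orth: "B (w i) (w j) = 0" if "i \<le> d" "j \<le> d" "i \<noteq> j" for i j
  proof -
    have "\<theta> i * B (w i) (w j) = \<theta> j * B (w i) (w j)"
      using B_A[of "w i" "w j"] that by (simp add: A_eigenvector B_scale B_scale')
    then show ?thesis using \<theta>_eq_iff that by simp
  qed
  have B_w: "B (w i) y = e i y * B (w i) (w i)" if "i \<le> d" for i y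
  proof -
    have "B (w i) y = B (w i) (\<Sum>j\<le>d. scale (e j y) (w j))" using eig.expansion[of y] by simp
    also have "\<dots> = (\<Sum>j\<le>d. e j y * B (w i) (w j))" by (simp add: B_sum B_scale)
    also have "\<dots> = e i y * B (w i) (w i)"
      by (rule sum_eq_single_term) (use that B_orth in auto)
    finally show ?thesis .
  qed
  have B_nz: "B (w i) (w i) \<noteq> 0" if "i \<le> d" for i
  proof
    assume 0: "B (w i) (w i) = 0"
    have "c j (w i) = 0" if "j \<le> d" for j
    proof -
      have "B (w i) (v j) = \<kappa> j * c j (w i) * c j (v j)"
        unfolding B_def by (rule sum_eq_single_term) (use that coord_basis in auto)
      then show ?thesis using B_w[OF \<open>i \<le> d\<close>, of "v j"] 0 \<kappa>_nz that coord_basis by simp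
    qed
    then have "w i = 0" by (intro coord_eqI) (simp add: coord_zero)
    then show False using eig.basis_nonzero that by simp
  qed
  have "s i j * B (w i) (w i) = s j i * B (w j) (w j)"
    using B_w[OF assms(1), of "As (w j)"] B_w[OF assms(2), of "As (w i)"]
      B_As[of "w i" "w j"] B_sym by metis
  then show ?thesis using B_nz assms by (metis mult_eq_0_iff)
qed

text \<open>
  The product of the operators \<open>As - \<phi> k\<close> over \<open>1 \<le> k \<le> d\<close> annihilates every \<open>v k\<close> except
  \<open>v 0\<close>, which it multiplies by a nonzero scalar. Hence the subspace contains \<open>v 0\<close>, and the
  subdiagonal entries of \<open>A\<close> lead from \<open>v n\<close> to \<open>v (n + 1)\<close>.
\<close>

lemma invariant_subspace_is_UNIV:
  assumes sub: "subspace U" and A: "\<And>x. x \<in> U \<Longrightarrow> A x \<in> U" and As: "\<And>x. x \<in> U \<Longrightarrow> As x \<in> U"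
    and \<phi>0: "\<And>i. 1 \<le> i \<Longrightarrow> i \<le> d \<Longrightarrow> \<phi> 0 \<noteq> \<phi> i"
    and x: "x \<in> U" "c 0 x \<noteq> 0"
  shows "U = UNIV"
proof -
  have ex: "\<exists>y\<in>U. \<forall>i\<le>d. c i y = (\<Prod>k=1..n. \<phi> i - \<phi> k) * c i x" for n
  proof (induction n)
    case (Suc n)
    then obtain y where y: "y \<in> U" "\<forall>i\<le>d. c i y = (\<Prod>k=1..n. \<phi> i - \<phi> k) * c i x" by auto
    have "As y - scale (\<phi> (Suc n)) y \<in> U"
      using y(1) As sub by (simp add: subspace_diff subspace_scale)
    moreover have "\<forall>i\<le>d. c i (As y - scale (\<phi> (Suc n)) y) = (\<Prod>k=1..Suc n. \<phi> i - \<phi> k) * c i x"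
      using y(2) by (simp add: coord_diff coord_scale c_As algebra_simps)
    ultimately show ?case by blast
  qed (use x in auto)
  obtain y where y: "y \<in> U" "\<And>i. i \<le> d \<Longrightarrow> c i y = (\<Prod>k=1..d. \<phi> i - \<phi> k) * c i x"
    using ex[of d] by auto
  have "c i y = 0" if "i \<le> d" "i \<noteq> 0" for i
    using y(2)[OF that(1)] that by (simp add: prod_zero_iff) auto
  then have "y = scale (c 0 y) (v 0)"
    by (intro coord_eqI) (simp add: coord_scale coord_basis)
  moreover have "c 0 y \<noteq> 0" using y(2)[of 0] x(2) \<phi>0 by auto
  ultimately have "v 0 = scale (inverse (c 0 y)) y"
    by (metis scale_scale left_inverse scale_one)
  then have "v 0 \<in> U" using y(1) sub by (metis subspace_scale)
  have vU: "\<forall>k\<le>n. v k \<in> U" if "n \<le> d" for n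
    using that
  proof (induction n)
    case (Suc n)
    have "A (v n) = (\<Sum>l\<le>Suc n. scale (a l n) (v l))"
      using Suc.prems A_tridiagonal by (intro expansion_along[where \<pi> = "\<lambda>l. l"]) auto
    moreover have "A (v n) \<in> U" using Suc A by simp
    ultimately have "(\<Sum>l\<le>Suc n. scale (a l n) (v l)) \<in> U" by (rule subst)
    then have "(\<Sum>l\<le>n. scale (a l n) (v l)) + scale (a (Suc n) n) (v (Suc n)) \<in> U" by simp
    moreover have "(\<Sum>l\<le>n. scale (a l n) (v l)) \<in> U"
      using Suc sub by (intro subspace_sum subspace_scale) auto
    moreover have "a (Suc n) n \<noteq> 0" using A_irreducible[of n] Suc.prems by simp
    ultimately have "v (Suc n) \<in> U" by (rule subspace_cancel[OF sub])
    then show ?case using Suc by (auto simp: le_Suc_eq)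
  qed (use \<open>v 0 \<in> U\<close> in auto)
  have "z \<in> U" for z
    by (subst expansion[of z]) (use vU[of d] sub in \<open>auto intro!: subspace_sum subspace_scale\<close>)
  then show ?thesis by auto
qed

text \<open>
  If no edge of \<open>\<Delta>\<close> left \<open>S\<close>, the span of the \<open>w j\<close> with \<open>j \<in> S\<close> would be a proper nonzero
  subspace invariant under \<open>A\<close> and \<open>As\<close>.
\<close>

lemma graph_connected:
  assumes \<phi>0: "\<And>i. 1 \<le> i \<Longrightarrow> i \<le> d \<Longrightarrow> \<phi> 0 \<noteq> \<phi> i"
    and S: "S \<subseteq> {..d}" "S \<noteq> {}" "S \<noteq> {..d}"
  shows "\<exists>j\<in>S. \<exists>m\<le>d. m \<notin> S \<and> s m j \<noteq> 0"
proof (rule ccontr)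
  assume "\<not> ?thesis"
  then have closed: "s m j = 0" if "j \<in> S" "m \<le> d" "m \<notin> S" for j m using that by blast
  define U where "U = {x. \<forall>m\<le>d. m \<notin> S \<longrightarrow> e m x = 0}"
  have "subspace U"
    by (simp add: U_def subspace_def eig.coord_simps)
  moreover have "A x \<in> U" if "x \<in> U" for x using that by (simp add: U_def e_A)
  moreover have "As x \<in> U" if "x \<in> U" for x
  proof -
    have "s m j * e j x = 0" if "m \<le> d" "m \<notin> S" "j \<le> d" for m j
      using \<open>x \<in> U\<close> closed that by (cases "j \<in> S") (auto simp: U_def)
    then show ?thesis by (auto simp: U_def e_As[of _ x] intro!: sum.neutral)
  qed
  moreover obtain j where j: "j \<in> S" "j \<le> d" using S by auto
  moreover have "w j \<in> U" using j S by (auto simp: U_def eig.coord_basis)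
  moreover have "c 0 (w j) \<noteq> 0"
    using first_coordinate_nonzero A_eigenvector eig.basis_nonzero j by blast
  ultimately have "U = UNIV" using invariant_subspace_is_UNIV \<phi>0 by blast
  obtain m where m: "m \<le> d" "m \<notin> S" using S by auto
  have "w m \<in> U" using \<open>U = UNIV\<close> by simp
  then show False using m eig.coord_basis by (auto simp: U_def)
qed

section \<open>Growing the path from its tail\<close>

text \<open>
  One of the two Askey--Wilson relations of a Leonard pair says that this operator equals
  \<open>\<alpha> As\<^sup>2 + \<omega> As + \<eta>\<close> for suitable scalars \<open>\<alpha>\<close>, \<open>\<omega>\<close>, \<open>\<eta>\<close>.
\<close>

definition \<Phi> :: "'k \<Rightarrow> 'k \<Rightarrow> 'k \<Rightarrow> 'v \<Rightarrow> 'v" where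
  "\<Phi> \<beta> \<gamma> \<rho> x = As (As (A x)) - scale \<beta> (As (A (As x))) + A (As (As x))
     - scale \<gamma> (A (As x) + As (A x)) - scale \<rho> (A x)"

lemma \<Phi>_linear: "Vector_Spaces.linear scale scale (\<Phi> \<beta> \<gamma> \<rho>)"
  by (simp add: Vector_Spaces.linear_iff vector_space_axioms \<Phi>_def A.add A.scale As.add As.scale
      algebra_simps)

text \<open>
  The \<open>(i, j)\<close> entry of \<open>\<Phi> \<beta> \<gamma> \<rho>\<close> in the basis \<open>v\<close> is \<open>a i j\<close> times a symmetric quadratic
  expression in \<open>\<phi> i\<close>, \<open>\<phi> j\<close>. The assumption makes this expression vanish for consecutive \<open>i\<close>, \<open>j\<close>,
  and \<open>a i j\<close> vanishes for indices further apart. So \<open>\<Phi> \<beta> \<gamma> \<rho>\<close> is diagonal in the basis \<open>v\<close>, like \<open>As\<close>.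
\<close>

lemma \<Phi>_commutes_As:
  assumes "\<And>i. Suc i \<le> d \<Longrightarrow>
    (\<phi> i)\<^sup>2 - \<beta> * \<phi> i * \<phi> (Suc i) + (\<phi> (Suc i))\<^sup>2 - \<gamma> * (\<phi> i + \<phi> (Suc i)) = \<rho>"
  shows "\<Phi> \<beta> \<gamma> \<rho> (As x) = As (\<Phi> \<beta> \<gamma> \<rho> x)"
proof -
  let ?g = "\<lambda>i j. (\<phi> i)\<^sup>2 - \<beta> * \<phi> i * \<phi> j + (\<phi> j)\<^sup>2 - \<gamma> * (\<phi> i + \<phi> j) - \<rho>"
  define f where "f j = c j (\<Phi> \<beta> \<gamma> \<rho> (v j))" for j
  have entry: "c i (\<Phi> \<beta> \<gamma> \<rho> (v j)) = a i j * ?g i j" if "i \<le> d" "j \<le> d" for i j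
    using that
    by (simp add: \<Phi>_def coord_simps c_As As_eigenvector A.scale As.scale power2_eq_square algebra_simps)
  have off: "a i j * ?g i j = 0" if "i \<le> d" "j \<le> d" "i \<noteq> j" for i j
  proof -
    consider "j = Suc i" | "i = Suc j" | "Suc i < j \<or> Suc j < i" using \<open>i \<noteq> j\<close> by linarith
    then show ?thesis
    proof cases
      case 1
      then show ?thesis using assms[of i] that by simp
    next
      case 2
      have "?g i j = ?g j i" by (simp add: algebra_simps)
      then show ?thesis using 2 assms[of j] that by simp
    next
      case 3
      then show ?thesis using A_tridiagonal that by simp
    qed
  qed
  have diag: "\<Phi> \<beta> \<gamma> \<rho> (v j) = scale (f j) (v j)" if "j \<le> d" for j
  proof (rule coord_eqI)
    fix i assume "i \<le> d"
    then show "c i (\<Phi> \<beta> \<gamma> \<rho> (v j)) = c i (scale (f j) (v j))"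
      using entry[of i j] off[of i j] that
      by (cases "i = j") (auto simp: coord_scale coord_basis f_def)
  qed
  have "c i (\<Phi> \<beta> \<gamma> \<rho> y) = f i * c i y" if "i \<le> d" for i y
    using coord_of_diagonal_image[OF \<Phi>_linear diag that] .
  then show ?thesis by (intro coord_eqI) (simp add: c_As)
qed

text \<open>
  An initial part of the path that \<open>\<Delta>\<close> turns out to be. No condition is put on the neighbours of
  the last vertex \<open>\<pi> n\<close>: one of them is the next vertex of the path. For \<open>k = 0\<close> the interval
  \<open>{k - 1..Suc k}\<close> is \<open>{0..1}\<close>, since the difference is truncated.
\<close>

definition path_segment :: "nat \<Rightarrow> (nat \<Rightarrow> nat) \<Rightarrow> bool" where
  "path_segment n \<pi> \<longleftrightarrow> inj_on \<pi> {..n} \<and> \<pi> ` {..n} \<subseteq> {..d} \<and>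
    (\<forall>k<n. s (\<pi> (Suc k)) (\<pi> k) \<noteq> 0 \<and>
       (\<forall>m\<le>d. s m (\<pi> k) \<noteq> 0 \<longrightarrow> m \<in> \<pi> ` {k - 1..Suc k}))"

lemma path_segment_le: "path_segment n \<pi> \<Longrightarrow> k \<le> n \<Longrightarrow> \<pi> k \<le> d"
  by (auto simp: path_segment_def)

lemma path_segment_inj: "path_segment n \<pi> \<Longrightarrow> k \<le> n \<Longrightarrow> l \<le> n \<Longrightarrow> \<pi> k = \<pi> l \<longleftrightarrow> k = l"
  by (auto simp: path_segment_def dest: inj_onD)

lemma path_segment_step: "path_segment n \<pi> \<Longrightarrow> k < n \<Longrightarrow> s (\<pi> (Suc k)) (\<pi> k) \<noteq> 0"
  by (simp add: path_segment_def)

lemma path_segment_neighbour: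
  assumes "path_segment n \<pi>" "k < n" "m \<le> d" "s m (\<pi> k) \<noteq> 0"
  shows "\<exists>l\<le>n. m = \<pi> l \<and> k \<le> Suc l \<and> l \<le> Suc k"
proof -
  have "m \<in> \<pi> ` {k - 1..Suc k}" using assms by (auto simp: path_segment_def)
  then obtain l where "m = \<pi> l" "k - 1 \<le> l" "l \<le> Suc k" by auto
  then show ?thesis using assms(2) by (intro exI[of _ l]) auto
qed

lemma path_segment_support:
  assumes "path_segment n \<pi>" "k < n"
    and y: "\<And>m. m \<le> d \<Longrightarrow> m \<notin> \<pi> ` {..k} \<Longrightarrow> e m y = 0"
  shows "m \<le> d \<Longrightarrow> m \<notin> \<pi> ` {..Suc k} \<Longrightarrow> e m (As y) = 0"
    and "e (\<pi> (Suc k)) (As y) = s (\<pi> (Suc k)) (\<pi> k) * e (\<pi> k) y"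
proof -
  assume m: "m \<le> d" "m \<notin> \<pi> ` {..Suc k}"
  have "s m j * e j y = 0" if "j \<le> d" for j
  proof (cases "j \<in> \<pi> ` {..k}")
    case True
    then obtain l where l: "j = \<pi> l" "l \<le> k" by auto
    have "s m (\<pi> l) = 0"
    proof (rule ccontr)
      assume "s m (\<pi> l) \<noteq> 0"
      then obtain l' where "m = \<pi> l'" "l' \<le> Suc l"
        using path_segment_neighbour[OF assms(1), of l m] l m assms(2) by auto
      then show False using m l by auto
    qed
    then show ?thesis using l by simp
  qed (use y that in auto)
  then show "e m (As y) = 0" by (auto simp: e_As[of m y] intro!: sum.neutral)
next
  have "e (\<pi> (Suc k)) (As y) = (\<Sum>j\<le>d. s (\<pi> (Suc k)) j * e j y)" by (rule e_As)
  also have "\<dots> = s (\<pi> (Suc k)) (\<pi> k) * e (\<pi> k) y"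
  proof (rule sum_eq_single_term)
    fix j assume j: "j \<in> {..d}" "j \<noteq> \<pi> k"
    show "s (\<pi> (Suc k)) j * e j y = 0"
    proof (cases "j \<in> \<pi> ` {..k}")
      case True
      then obtain l where l: "j = \<pi> l" "l \<le> k" by auto
      then have "l < k" using j by (cases "l = k") auto
      have "s (\<pi> (Suc k)) (\<pi> l) = 0"
      proof (rule ccontr)
        assume "s (\<pi> (Suc k)) (\<pi> l) \<noteq> 0"
        moreover have "\<pi> (Suc k) \<le> d" using path_segment_le assms by simp
        ultimately obtain l' where "\<pi> (Suc k) = \<pi> l'" "l' \<le> Suc l" "l' \<le> n"
          using path_segment_neighbour[OF assms(1), of l "\<pi> (Suc k)"] l assms(2) by auto
        then show False using path_segment_inj[OF assms(1), of "Suc k" l'] \<open>l < k\<close> assms(2) by simp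
      qed
      then show ?thesis using l by simp
    qed (use y j in auto)
  qed (use path_segment_le[OF assms(1)] assms(2) in auto)
  finally show "e (\<pi> (Suc k)) (As y) = s (\<pi> (Suc k)) (\<pi> k) * e (\<pi> k) y" .
qed

text \<open>
  \<open>As (w (\<pi> k))\<close> is a combination of \<open>w (\<pi> 0), \<dots>, w (\<pi> (k + 1))\<close> in which the last coefficient
  is nonzero, so \<open>w (\<pi> 0)\<close> generates the vectors along the path under \<open>As\<close>.
\<close>

lemma path_segment_invariant_subspace:
  assumes \<pi>: "path_segment n \<pi>" and K: "subspace K" "\<And>x. x \<in> K \<Longrightarrow> As x \<in> K" "w (\<pi> 0) \<in> K"
    and "k \<le> n"
  shows "w (\<pi> k) \<in> K"
proof -
  have "\<forall>l\<le>k. w (\<pi> l) \<in> K" using \<open>k \<le> n\<close>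
  proof (induction k)
    case (Suc k)
    let ?y = "w (\<pi> k)"
    have y: "e m ?y = 0" if "m \<le> d" "m \<notin> \<pi> ` {..k}" for m
      using that path_segment_le[OF \<pi>, of k] Suc.prems by (auto simp: eig.coord_basis)
    have "As ?y = (\<Sum>l\<le>Suc k. scale (s (\<pi> l) (\<pi> k)) (w (\<pi> l)))"
    proof (rule eig.expansion_along)
      show "inj_on \<pi> {..Suc k}" "\<pi> ` {..Suc k} \<subseteq> {..d}"
        using path_segment_inj[OF \<pi>] path_segment_le[OF \<pi>] Suc.prems by (auto simp: inj_on_def)
      show "s m (\<pi> k) = 0" if "m \<le> d" "m \<notin> \<pi> ` {..Suc k}" for m
        by (rule path_segment_support(1)[OF \<pi> _ _ that]) (use Suc.prems y in auto)
    qed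
    moreover have "As ?y \<in> K" using K(2) Suc by simp
    ultimately have "(\<Sum>l\<le>Suc k. scale (s (\<pi> l) (\<pi> k)) (w (\<pi> l))) \<in> K" by (rule subst)
    then have "(\<Sum>l\<le>k. scale (s (\<pi> l) (\<pi> k)) (w (\<pi> l)))
        + scale (s (\<pi> (Suc k)) (\<pi> k)) (w (\<pi> (Suc k))) \<in> K" by simp
    moreover have "(\<Sum>l\<le>k. scale (s (\<pi> l) (\<pi> k)) (w (\<pi> l))) \<in> K"
      using Suc K(1) by (intro subspace_sum subspace_scale) auto
    moreover have "s (\<pi> (Suc k)) (\<pi> k) \<noteq> 0" using path_segment_step[OF \<pi>] Suc.prems by simp
    ultimately have "w (\<pi> (Suc k)) \<in> K" by (rule subspace_cancel[OF K(1)])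
    then show ?case using Suc by (auto simp: le_Suc_eq)
  qed (use K in auto)
  then show ?thesis by simp
qed

text \<open>
  Each term of \<open>\<Phi>\<close> applies \<open>As\<close> at most twice, so \<open>\<Phi> (w (\<pi> 0))\<close> lies in the span of \<open>w (\<pi> 0)\<close>,
  \<open>w (\<pi> 1)\<close> and \<open>w (\<pi> 2)\<close>. The three vectors on the right are triangular with respect to that
  basis, with nonzero diagonal coefficients \<open>s21 * s10\<close>, \<open>s10\<close> and \<open>1\<close>.
\<close>

lemma \<Phi>_on_tail:
  assumes \<pi>: "path_segment 2 \<pi>"
  obtains \<alpha> \<omega> \<eta> where "\<Phi> \<beta> \<gamma> \<rho> (w (\<pi> 0)) =
    scale \<alpha> (As (As (w (\<pi> 0)))) + scale \<omega> (As (w (\<pi> 0))) + scale \<eta> (w (\<pi> 0))"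
proof -
  define supp where "supp k y \<longleftrightarrow> (\<forall>m\<le>d. m \<notin> \<pi> ` {..k} \<longrightarrow> e m y = 0)" for k :: nat and y
  have supp_A: "supp k (A y)" if "supp k y" for k y using that by (simp add: supp_def e_A)
  have supp_As: "supp (Suc k) (As y)" if "supp k y" "k < 2" for k y
    using path_segment_support(1)[OF \<pi> that(2), of y] that(1) by (auto simp: supp_def)
  have supp_mono: "supp l y" if "supp k y" "k \<le> l" for k l y
    using that by (fastforce simp: supp_def)
  have lead: "e (\<pi> (Suc k)) (As y) = s (\<pi> (Suc k)) (\<pi> k) * e (\<pi> k) y" if "supp k y" "k < 2" for k y
    using path_segment_support(2)[OF \<pi> that(2), of y] that(1) by (auto simp: supp_def)
  let ?x = "w (\<pi> 0)" and ?y = "\<Phi> \<beta> \<gamma> \<rho> (w (\<pi> 0))"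
  have le: "\<pi> 0 \<le> d" "\<pi> 1 \<le> d" "\<pi> 2 \<le> d" using path_segment_le[OF \<pi>] by auto
  have distinct: "\<pi> 1 \<noteq> \<pi> 0" "\<pi> 2 \<noteq> \<pi> 0" "\<pi> 2 \<noteq> \<pi> 1"
    using path_segment_inj[OF \<pi>, of 1 0] path_segment_inj[OF \<pi>, of 2 0]
      path_segment_inj[OF \<pi>, of 2 1] by auto
  have x0: "supp 0 ?x" using le by (auto simp: supp_def eig.coord_basis)
  have x1: "supp 1 (As ?x)" "supp 1 (As (A ?x))" "supp 1 (A (As ?x))"
    using supp_As[of 0] supp_A x0 by auto
  have x2: "supp 2 (As (As ?x))" "supp 2 (As (As (A ?x)))" "supp 2 (As (A (As ?x)))"
    using supp_As[of 1] supp_A x1 by (auto simp: numeral_2_eq_2)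
  have y: "supp 2 ?y"
    using x2 supp_A[OF x2(1)] supp_mono[OF supp_A[OF x0], of 2] x1[THEN supp_mono, of 2]
    unfolding \<Phi>_def supp_def by (simp add: eig.coord_simps)
  define s10 s21 where "s10 = s (\<pi> 1) (\<pi> 0)" and "s21 = s (\<pi> 2) (\<pi> 1)"
  have nz: "s10 \<noteq> 0" "s21 \<noteq> 0"
    using path_segment_step[OF \<pi>, of 0] path_segment_step[OF \<pi>, of 1]
    by (auto simp: s10_def s21_def numeral_2_eq_2)
  have e1: "e (\<pi> 1) (As ?x) = s10" using s10_def by simp
  have e2: "e (\<pi> 2) (As (As ?x)) = s21 * s10" "e (\<pi> 2) (As ?x) = 0"
    using lead[OF x1(1)] x1(1) le distinct e1
    by (auto simp: s21_def numeral_2_eq_2 supp_def le_Suc_eq)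
  define \<alpha> where "\<alpha> = e (\<pi> 2) ?y / (s21 * s10)"
  define \<omega> where "\<omega> = (e (\<pi> 1) ?y - \<alpha> * e (\<pi> 1) (As (As ?x))) / s10"
  define \<eta> where "\<eta> = e (\<pi> 0) ?y - \<alpha> * e (\<pi> 0) (As (As ?x)) - \<omega> * e (\<pi> 0) (As ?x)"
  show ?thesis
  proof (rule that, rule eig.coord_eqI)
    fix m assume m: "m \<le> d"
    have "{..2::nat} = {0, 1, 2}" by auto
    then consider "m \<notin> \<pi> ` {..2}" | "m = \<pi> 0" | "m = \<pi> 1" | "m = \<pi> 2"
      by auto
    then show "e m ?y = e m (scale \<alpha> (As (As ?x)) + scale \<omega> (As ?x) + scale \<eta> ?x)"
    proof cases
      case 1
      then have "e m ?y = 0" "e m (As (As ?x)) = 0" "e m (As ?x) = 0" "e m ?x = 0"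
        using m y x2(1) supp_mono[OF x1(1), of 2] supp_mono[OF x0, of 2] by (auto simp: supp_def)
      then show ?thesis by (simp add: eig.coord_simps)
    qed (use nz le distinct e1 e2 in
        \<open>auto simp: eig.coord_simps eig.coord_basis \<alpha>_def \<omega>_def \<eta>_def s10_def[symmetric]\<close>)
  qed
qed

text \<open>
  This is the step where the eigenvalues of \<open>A\<close> decide how the path continues. The vectors on which
  \<open>\<Phi>\<close> agrees with \<open>\<alpha> As\<^sup>2 + \<omega> As + \<eta>\<close> form a subspace invariant under \<open>As\<close>, so it contains
  \<open>w (\<pi> (n - 1))\<close>. In the coefficient of \<open>w m\<close> there, only walks of length two from \<open>\<pi> (n - 1)\<close>
  to \<open>m\<close> contribute, and all of them pass through \<open>\<pi> n\<close>.
\<close>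

lemma next_neighbour_unique:
  assumes \<pi>: "path_segment n \<pi>" "1 \<le> n"
    and comm: "\<And>x. \<Phi> \<beta> \<gamma> \<rho> (As x) = As (\<Phi> \<beta> \<gamma> \<rho> x)"
    and tail: "\<Phi> \<beta> \<gamma> \<rho> (w (\<pi> 0)) =
      scale \<alpha> (As (As (w (\<pi> 0)))) + scale \<omega> (As (w (\<pi> 0))) + scale \<eta> (w (\<pi> 0))"
    and m: "m \<le> d" "m \<notin> \<pi> ` {..n}" "s m (\<pi> n) \<noteq> 0"
  shows "\<theta> m = \<beta> * \<theta> (\<pi> n) - \<theta> (\<pi> (n - 1)) + \<alpha>"
proof -
  interpret \<Phi>: Vector_Spaces.linear scale scale "\<Phi> \<beta> \<gamma> \<rho>" by (rule \<Phi>_linear)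
  obtain p where n: "n = Suc p" using \<pi>(2) by (cases n) auto
  define K where "K = {x. \<Phi> \<beta> \<gamma> \<rho> x = scale \<alpha> (As (As x)) + scale \<omega> (As x) + scale \<eta> x}"
  have "subspace K"
    by (simp add: K_def subspace_def \<Phi>.add \<Phi>.scale As.add As.scale algebra_simps)
  moreover have "As x \<in> K" if "x \<in> K" for x
    using that by (simp add: K_def comm As.add As.scale)
  moreover have "w (\<pi> 0) \<in> K" using tail by (simp add: K_def)
  ultimately have "w (\<pi> p) \<in> K" using path_segment_invariant_subspace[OF \<pi>(1)] n by simp
  let ?x = "w (\<pi> p)"
  have \<Phi>x: "\<Phi> \<beta> \<gamma> \<rho> ?x = scale \<alpha> (As (As ?x)) + scale \<omega> (As ?x) + scale \<eta> ?x"
    using \<open>?x \<in> K\<close> by (simp add: K_def)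
  have le: "\<pi> p \<le> d" "\<pi> n \<le> d" using path_segment_le[OF \<pi>(1)] n by auto
  have ne: "m \<noteq> \<pi> p" using m n by auto
  have sm: "s m (\<pi> l) = 0" if "l \<le> p" for l
    using path_segment_neighbour[OF \<pi>(1), of l m] that m n by force
  have through_n: "e m (As y) = s m (\<pi> n) * e (\<pi> n) y"
    if "\<And>r. r \<le> d \<Longrightarrow> r \<notin> \<pi> ` {..n} \<Longrightarrow> e r y = 0" for y
    unfolding e_As[of m y]
  proof (rule sum_eq_single_term)
    fix j assume "j \<in> {..d}" "j \<noteq> \<pi> n"
    then show "s m j * e j y = 0"
      using that[of j] sm n by (cases "j \<in> \<pi> ` {..n}") (auto simp: le_Suc_eq)
  qed (use le in auto)
  have supp: "e r (As ?x) = 0" if "r \<le> d" "r \<notin> \<pi> ` {..n}" for r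
    by (rule path_segment_support(1)[OF \<pi>(1), where k = p])
      (use that n le in \<open>auto simp: eig.coord_basis\<close>)
  have 1: "e m (As (As ?x)) = s m (\<pi> n) * s (\<pi> n) (\<pi> p)"
    using through_n[of "As ?x"] supp by simp
  have 2: "e m (As (A (As ?x))) = s m (\<pi> n) * (\<theta> (\<pi> n) * s (\<pi> n) (\<pi> p))"
    using through_n[of "A (As ?x)"] supp le by (simp add: e_A)
  have 3: "e m (As ?x) = 0" "e m ?x = 0"
    using sm[of p] le m ne by (auto simp: eig.coord_basis)
  have "s m (\<pi> n) * s (\<pi> n) (\<pi> p) * (\<theta> (\<pi> p) - \<beta> * \<theta> (\<pi> n) + \<theta> m - \<alpha>) = 0"
    using arg_cong[OF \<Phi>x, of "e m"] m le 1 2 3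
    by (simp add: \<Phi>_def eig.coord_simps A_eigenvector As.scale e_A algebra_simps)
  moreover have "s (\<pi> n) (\<pi> p) \<noteq> 0" using path_segment_step[OF \<pi>(1), of p] n by simp
  ultimately have "\<theta> (\<pi> p) - \<beta> * \<theta> (\<pi> n) + \<theta> m - \<alpha> = 0" using m(3) by simp
  then show ?thesis using n by (simp add: algebra_simps)
qed

text \<open>
  Connectedness provides an edge leaving the segment, and only the last vertex can be its origin.
  Neighbours of the last vertex that lie on the segment are excluded by symmetry of \<open>\<Delta>\<close>, apart
  from its predecessor.
\<close>

lemma path_segment_extend:
  assumes \<phi>0: "\<And>i. 1 \<le> i \<Longrightarrow> i \<le> d \<Longrightarrow> \<phi> 0 \<noteq> \<phi> i"
    and \<pi>: "path_segment n \<pi>" "n < d"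
    and unique: "\<And>m m'. m \<le> d \<Longrightarrow> m' \<le> d \<Longrightarrow> m \<notin> \<pi> ` {..n} \<Longrightarrow> m' \<notin> \<pi> ` {..n} \<Longrightarrow>
      s m (\<pi> n) \<noteq> 0 \<Longrightarrow> s m' (\<pi> n) \<noteq> 0 \<Longrightarrow> m = m'"
  shows "\<exists>m\<le>d. s m (\<pi> n) \<noteq> 0 \<and> m \<notin> \<pi> ` {..n} \<and> path_segment (Suc n) (\<pi>(Suc n := m))"
proof -
  let ?S = "\<pi> ` {..n}"
  have inj: "inj_on \<pi> {..n}" and S: "?S \<subseteq> {..d}" using \<pi>(1) by (auto simp: path_segment_def)
  have "card ?S = Suc n" using inj by (simp add: card_image)
  then have "?S \<noteq> {..d}" using \<pi>(2) by auto
  then obtain k m where k: "k \<le> n" and m: "m \<le> d" "m \<notin> ?S" "s m (\<pi> k) \<noteq> 0"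
    using graph_connected[OF \<phi>0 S] by fastforce
  have "k = n"
  proof (rule ccontr)
    assume "k \<noteq> n"
    then have "k < n" using k by simp
    then show False
      using path_segment_neighbour[OF \<pi>(1) _ m(1,3)] m(2) by auto
  qed
  then have sm: "s m (\<pi> n) \<noteq> 0" using m by simp
  let ?\<pi> = "\<pi>(Suc n := m)"
  have "path_segment (Suc n) ?\<pi>"
    unfolding path_segment_def
  proof (intro conjI allI impI)
    show "inj_on ?\<pi> {..Suc n}"
      using inj m(2) by (auto simp: inj_on_def le_Suc_eq)
    show "?\<pi> ` {..Suc n} \<subseteq> {..d}" using path_segment_le[OF \<pi>(1)] m(1) by (auto simp: le_Suc_eq)
    fix k assume k: "k < Suc n"
    show "s (?\<pi> (Suc k)) (?\<pi> k) \<noteq> 0"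
      using k sm path_segment_step[OF \<pi>(1), of k] by (cases "k = n") auto
    fix r assume r: "r \<le> d" "s r (?\<pi> k) \<noteq> 0"
    show "r \<in> ?\<pi> ` {k - 1..Suc k}"
    proof (cases "k = n")
      case False
      then have "k < n" using k by simp
      then obtain l where "r = \<pi> l" "k \<le> Suc l" "l \<le> Suc k" "l \<le> n"
        using path_segment_neighbour[OF \<pi>(1), of k r] r k by auto
      then show ?thesis by (intro image_eqI[of _ _ l]) auto
    next
      case True
      show ?thesis
      proof (cases "r \<in> ?S")
        case False
        then have "r = m" using unique[of r m] r m sm True by auto
        then show ?thesis using True by (intro image_eqI[of _ _ "Suc n"]) auto
      next
        case r': True
        then obtain l where l: "r = \<pi> l" "l \<le> n" by auto
        have "n \<le> Suc l"
        proof (rule ccontr)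
          assume "\<not> n \<le> Suc l"
          then have "l < n" by simp
          moreover have "s (\<pi> n) (\<pi> l) \<noteq> 0"
            using r l True s_zero_symmetric[of r "\<pi> n"] path_segment_le[OF \<pi>(1), of n] by simp
          moreover have "\<pi> n \<le> d" using path_segment_le[OF \<pi>(1)] by simp
          ultimately obtain l' where "\<pi> n = \<pi> l'" "l' \<le> Suc l" "l' \<le> n"
            using path_segment_neighbour[OF \<pi>(1), of l "\<pi> n"] by auto
          then show False using path_segment_inj[OF \<pi>(1), of n l'] \<open>\<not> n \<le> Suc l\<close> by simp
        qed
        then show ?thesis using l True by (intro image_eqI[of _ _ l]) auto
      qed
    qed
  qed
  then show ?thesis using m sm by auto
qed

text \<open>
  The tail condition makes the first two extensions unique; from then on the vector identity for
  \<open>\<Phi>\<close> at \<open>w p\<close> is available and \<open>next_neighbour_unique\<close> takes over.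
\<close>

lemma path_of_tail:
  assumes "1 \<le> d" and ends: "p \<le> d" "q \<le> d" "p \<noteq> q"
    and tail_p: "\<And>k. k \<le> d \<Longrightarrow> k \<noteq> p \<Longrightarrow> s p k \<noteq> 0 \<Longrightarrow> k = q"
    and tail_q: "\<And>k k'. k \<le> d \<Longrightarrow> k' \<le> d \<Longrightarrow> k \<notin> {p, q} \<Longrightarrow> k' \<notin> {p, q} \<Longrightarrow>
      s q k \<noteq> 0 \<Longrightarrow> s q k' \<noteq> 0 \<Longrightarrow> k = k'"
    and rec: "\<And>i. 1 \<le> i \<Longrightarrow> i < d \<Longrightarrow> \<phi> (i - 1) - \<beta> * \<phi> i + \<phi> (i + 1) = \<gamma>"
    and \<phi>0: "\<And>i. 1 \<le> i \<Longrightarrow> i \<le> d \<Longrightarrow> \<phi> 0 \<noteq> \<phi> i"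
  obtains \<pi> where "path_segment d \<pi>" "\<pi> 0 = p" "\<pi> 1 = q"
proof -
  define \<rho> where "\<rho> = (\<phi> 0)\<^sup>2 - \<beta> * \<phi> 0 * \<phi> 1 + (\<phi> 1)\<^sup>2 - \<gamma> * (\<phi> 0 + \<phi> 1)"
  \<comment> \<open>Consecutive values of the left side differ by \<open>\<phi> (i + 2) - \<phi> i\<close> times the defect of the
    recurrence, which is zero.\<close>
  have inv: "(\<phi> i)\<^sup>2 - \<beta> * \<phi> i * \<phi> (Suc i) + (\<phi> (Suc i))\<^sup>2 - \<gamma> * (\<phi> i + \<phi> (Suc i)) = \<rho>"
    if "Suc i \<le> d" for i
    using that
  proof (induction i)
    case (Suc i)
    let ?x = "\<phi> i" and ?y = "\<phi> (Suc i)" and ?z = "\<phi> (Suc (Suc i))"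
    have "?x - \<beta> * ?y + ?z = \<gamma>" using rec[of "Suc i"] Suc.prems by simp
    moreover have "(?y\<^sup>2 - \<beta> * ?y * ?z + ?z\<^sup>2 - \<gamma> * (?y + ?z)) -
        (?x\<^sup>2 - \<beta> * ?x * ?y + ?y\<^sup>2 - \<gamma> * (?x + ?y)) = (?z - ?x) * (?x - \<beta> * ?y + ?z - \<gamma>)"
      by (simp add: power2_eq_square algebra_simps)
    ultimately show ?case using Suc by simp
  qed (simp add: \<rho>_def)
  note comm = \<Phi>_commutes_As[OF inv]
  have seg0: "path_segment 0 (\<lambda>_. p)" using ends by (simp add: path_segment_def)
  have nb_p: "m = q" if "m \<le> d" "m \<noteq> p" "s m p \<noteq> 0" for m
    using tail_p that s_zero_symmetric ends by blast
  have "\<exists>m\<le>d. s m p \<noteq> 0 \<and> m \<notin> (\<lambda>_. p) ` {..0::nat} \<and> path_segment (Suc 0) ((\<lambda>_. p)(Suc 0 := m))"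
  proof (rule path_segment_extend[OF \<phi>0 seg0])
    show "m = m'" if "m \<le> d" "m' \<le> d" "m \<notin> (\<lambda>_. p) ` {..0::nat}" "m' \<notin> (\<lambda>_. p) ` {..0::nat}"
      "s m p \<noteq> 0" "s m' p \<noteq> 0" for m m'
      using nb_p[of m] nb_p[of m'] that by simp
  qed (use \<open>1 \<le> d\<close> in auto)
  then obtain m1 where m1: "m1 \<le> d" "s m1 p \<noteq> 0" "m1 \<noteq> p" "path_segment 1 ((\<lambda>_. p)(Suc 0 := m1))"
    by auto
  then have "m1 = q" using nb_p by blast
  define \<pi>1 where "\<pi>1 = (\<lambda>_::nat. p)(1 := q)"
  have seg1: "path_segment 1 \<pi>1" using m1 \<open>m1 = q\<close> by (simp add: \<pi>1_def)
  have \<pi>1: "\<pi>1 0 = p" "\<pi>1 1 = q" by (auto simp: \<pi>1_def)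
  show ?thesis
  proof (cases "d = 1")
    case True
    then show ?thesis using that seg1 \<pi>1 by simp
  next
    case False
    then have "2 \<le> d" using \<open>1 \<le> d\<close> by simp
    have im1: "\<pi>1 ` {..1} = {p, q}" using \<pi>1 by (auto simp: le_Suc_eq atMost_Suc)
    have nb_q: "m = m'" if "m \<le> d" "m' \<le> d" "m \<notin> {p, q}" "m' \<notin> {p, q}" "s m q \<noteq> 0" "s m' q \<noteq> 0" for m m'
      using tail_q that s_zero_symmetric ends by blast
    have "\<exists>m\<le>d. s m (\<pi>1 1) \<noteq> 0 \<and> m \<notin> \<pi>1 ` {..1} \<and> path_segment (Suc 1) (\<pi>1(Suc 1 := m))"
    proof (rule path_segment_extend[OF \<phi>0 seg1])
      show "m = m'" if "m \<le> d" "m' \<le> d" "m \<notin> \<pi>1 ` {..1}" "m' \<notin> \<pi>1 ` {..1}"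
        "s m (\<pi>1 1) \<noteq> 0" "s m' (\<pi>1 1) \<noteq> 0" for m m'
        by (rule nb_q) (use that im1 \<pi>1 in auto)
    qed (use \<open>2 \<le> d\<close> in auto)
    then obtain m2 where "path_segment (Suc 1) (\<pi>1(Suc 1 := m2))" by auto
    moreover define \<pi>2 where "\<pi>2 = \<pi>1(Suc 1 := m2)"
    ultimately have seg2: "path_segment 2 \<pi>2" by (simp add: numeral_2_eq_2)
    have \<pi>2: "\<pi>2 0 = p" "\<pi>2 1 = q" using \<pi>1 by (auto simp: \<pi>2_def)
    obtain \<alpha> \<omega> \<eta> where tail: "\<Phi> \<beta> \<gamma> \<rho> (w p) =
        scale \<alpha> (As (As (w p))) + scale \<omega> (As (w p)) + scale \<eta> (w p)"
      using \<Phi>_on_tail[OF seg2] \<pi>2 by metis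
    have "\<exists>\<pi>. path_segment n \<pi> \<and> \<pi> 0 = p \<and> \<pi> 1 = q" if "2 \<le> n" "n \<le> d" for n
      using that
    proof (induction n rule: dec_induct)
      case base
      then show ?case using seg2 \<pi>2 by auto
    next
      case (step n)
      then obtain \<pi> where \<pi>: "path_segment n \<pi>" "\<pi> 0 = p" "\<pi> 1 = q" by auto
      have unique: "m = m'" if "m \<le> d" "m' \<le> d" "m \<notin> \<pi> ` {..n}" "m' \<notin> \<pi> ` {..n}"
        "s m (\<pi> n) \<noteq> 0" "s m' (\<pi> n) \<noteq> 0" for m m'
      proof -
        have "\<theta> m = \<beta> * \<theta> (\<pi> n) - \<theta> (\<pi> (n - 1)) + \<alpha>"
          by (rule next_neighbour_unique[OF \<pi>(1) _ comm tail[folded \<pi>(2)]]) (use that step in auto)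
        moreover have "\<theta> m' = \<beta> * \<theta> (\<pi> n) - \<theta> (\<pi> (n - 1)) + \<alpha>"
          by (rule next_neighbour_unique[OF \<pi>(1) _ comm tail[folded \<pi>(2)]]) (use that step in auto)
        ultimately have "\<theta> m = \<theta> m'" by simp
        then show ?thesis using \<theta>_eq_iff that by blast
      qed
      have "n < d" using step.prems by simp
      then obtain m where "path_segment (Suc n) (\<pi>(Suc n := m))"
        using path_segment_extend[OF \<phi>0 \<pi>(1) _ unique] by auto
      moreover have "(\<pi>(Suc n := m)) 0 = p" "(\<pi>(Suc n := m)) 1 = q" using \<pi> step.hyps by auto
      ultimately show ?case by blast
    qed
    from this[OF \<open>2 \<le> d\<close> order_refl] show ?thesis using that by auto
  qed
qed

lemma full_path_bij:
  assumes "path_segment d \<pi>"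
  shows "bij_betw \<pi> {..d} {..d}"
  using assms endo_inj_surj[of "{..d}" \<pi>] by (simp add: bij_betw_def path_segment_def)

lemma full_path_tridiagonal:
  assumes \<pi>: "path_segment d \<pi>" and ij: "i \<le> d" "j \<le> d"
  shows "1 < \<bar>int i - int j\<bar> \<Longrightarrow> s (\<pi> i) (\<pi> j) = 0"
    and "\<bar>int i - int j\<bar> = 1 \<Longrightarrow> s (\<pi> i) (\<pi> j) \<noteq> 0"
proof -
  have far: "s (\<pi> i) (\<pi> j) = 0" if "i \<le> d" "Suc j < i" for i j
  proof (rule ccontr)
    assume "s (\<pi> i) (\<pi> j) \<noteq> 0"
    moreover have "\<pi> i \<le> d" using path_segment_le[OF \<pi>] that by simp
    ultimately obtain l where "\<pi> i = \<pi> l" "l \<le> Suc j" "l \<le> d"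
      using path_segment_neighbour[OF \<pi>, of j "\<pi> i"] \<open>i \<le> d\<close> \<open>Suc j < i\<close> by auto
    then show False using path_segment_inj[OF \<pi>, of i l] that by simp
  qed
  have sym: "s (\<pi> i) (\<pi> j) = 0 \<longleftrightarrow> s (\<pi> j) (\<pi> i) = 0"
    using s_zero_symmetric path_segment_le[OF \<pi>] ij by simp
  show "s (\<pi> i) (\<pi> j) = 0" if "1 < \<bar>int i - int j\<bar>"
  proof -
    have "Suc j < i \<or> Suc i < j" using that by linarith
    then show ?thesis using far[of i j] far[of j i] sym ij by blast
  qed
  show "s (\<pi> i) (\<pi> j) \<noteq> 0" if "\<bar>int i - int j\<bar> = 1"
  proof -
    have "i = Suc j \<or> j = Suc i" using that by linarith
    then show ?thesis using path_segment_step[OF \<pi>] sym ij by (metis Suc_le_lessD)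
  qed
qed

text \<open>
  If \<open>\<phi> i = \<phi> j\<close> with \<open>i \<noteq> j\<close>, some nontrivial combination of the coordinates \<open>c i\<close> and \<open>c j\<close>
  vanishes at \<open>w (\<pi> 0)\<close>. Its kernel is invariant under \<open>As\<close>, hence contains all \<open>w (\<pi> k)\<close>, that
  is, a basis.
\<close>

lemma full_path_eigenvalues_distinct:
  assumes \<pi>: "path_segment d \<pi>"
  shows "inj_on \<phi> {..d}"
proof (rule inj_onI, rule ccontr)
  fix i j assume ij: "i \<in> {..d}" "j \<in> {..d}" "\<phi> i = \<phi> j" "i \<noteq> j"
  let ?x = "w (\<pi> 0)"
  obtain r t where rt: "r * c i ?x + t * c j ?x = 0" "r \<noteq> 0 \<or> t \<noteq> 0"
  proof (cases "c i ?x = 0 \<and> c j ?x = 0")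
    case True
    then show ?thesis using that[of 1 0] by simp
  next
    case False
    then show ?thesis using that[of "c j ?x" "- c i ?x"] by (auto simp: mult.commute)
  qed
  define K where "K = {x. r * c i x + t * c j x = 0}"
  have "subspace K"
    unfolding K_def subspace_def
  proof (intro conjI ballI allI)
    fix x y assume "x \<in> {x. r * c i x + t * c j x = 0}" "y \<in> {x. r * c i x + t * c j x = 0}"
    moreover have "r * c i (x + y) + t * c j (x + y) = (r * c i x + t * c j x) + (r * c i y + t * c j y)"
      by (simp add: coord_add algebra_simps)
    ultimately show "x + y \<in> {x. r * c i x + t * c j x = 0}" by simp
  next
    fix z x assume "x \<in> {x. r * c i x + t * c j x = 0}"
    moreover have "r * c i (scale z x) + t * c j (scale z x) = z * (r * c i x + t * c j x)"
      by (simp add: coord_scale algebra_simps)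
    ultimately show "scale z x \<in> {x. r * c i x + t * c j x = 0}" by simp
  qed (simp add: coord_zero)
  moreover have "As x \<in> K" if "x \<in> K" for x
  proof -
    have "r * c i (As x) + t * c j (As x) = \<phi> i * (r * c i x + t * c j x)"
      using ij by (simp add: c_As algebra_simps)
    then show ?thesis using that by (simp add: K_def)
  qed
  moreover have "?x \<in> K" using rt by (simp add: K_def)
  ultimately have "w (\<pi> k) \<in> K" if "k \<le> d" for k
    using path_segment_invariant_subspace[OF \<pi>] that by blast
  then have "w m \<in> K" if "m \<le> d" for m
    using full_path_bij[OF \<pi>] that by (metis atMost_iff bij_betw_iff_bijections)
  then have "x \<in> K" for x
    by (subst eig.expansion[of x]) (use \<open>subspace K\<close> in \<open>auto intro!: subspace_sum subspace_scale\<close>)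
  then have "r * c i (v i) + t * c j (v i) = 0" "r * c i (v j) + t * c j (v j) = 0"
    unfolding K_def by blast+
  moreover have "c i (v i) = 1" "c j (v i) = 0" "c i (v j) = 0" "c j (v j) = 1"
    using ij coord_basis by auto
  ultimately have "r = 0" "t = 0" by simp_all
  with rt(2) show False by simp
qed

section \<open>The three-term recurrence of a Leonard system\<close>

definition vanishes_below :: "nat \<Rightarrow> 'v \<Rightarrow> bool" where
  "vanishes_below m x \<longleftrightarrow> (\<forall>k<m. c k x = 0)"

lemma vanishes_below_basis: "j \<le> d \<Longrightarrow> vanishes_below j (v j)"
  by (simp add: vanishes_below_def coord_basis)

lemma vanishes_below_As: "vanishes_below m x \<Longrightarrow> m \<le> d \<Longrightarrow> vanishes_below m (As x)"
  by (simp add: vanishes_below_def c_As)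

text \<open>
  For \<open>x = v j\<close>, repeated use computes the outermost nonzero superdiagonal of a product of copies
  of \<open>A\<close> and \<open>As\<close>.
\<close>

lemma vanishes_below_A:
  assumes "vanishes_below (Suc m) x" "m < d"
  shows "vanishes_below m (A x)" and "c m (A x) = a m (Suc m) * c (Suc m) x"
proof -
  have "a k j * c j x = 0" if "k < m" "j \<le> d" for k j
    using assms A_tridiagonal[of k j] that by (cases "j \<le> m") (auto simp: vanishes_below_def)
  then show "vanishes_below m (A x)"
    by (auto simp: vanishes_below_def c_A[of _ x] intro!: sum.neutral)
  have "c m (A x) = (\<Sum>j\<le>d. a m j * c j x)" by (rule c_A)
  also have "\<dots> = a m (Suc m) * c (Suc m) x"
  proof (rule sum_eq_single_term)
    fix j assume "j \<in> {..d}" "j \<noteq> Suc m"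
    then show "a m j * c j x = 0"
      using assms A_tridiagonal[of m j] by (cases "j \<le> m") (auto simp: vanishes_below_def)
  qed (use assms in auto)
  finally show "c m (A x) = a m (Suc m) * c (Suc m) x" .
qed

text \<open>
  In the basis \<open>w\<close>, entry \<open>(i, j)\<close> of \<open>A\<^sup>2 As A - A As A\<^sup>2\<close> is \<open>s i j\<close> times an expression
  antisymmetric in \<open>i\<close>, \<open>j\<close>. For tridiagonal \<open>s\<close> only neighbouring \<open>i\<close>, \<open>j\<close> matter, and there an
  antisymmetric expression is a difference \<open>z i - z j\<close>; so the operator is the commutator of
  \<open>As\<close> with the operator \<open>Z\<close> that is diagonal with entries \<open>z i\<close>. The recurrence then follows from
  the third superdiagonal in the basis \<open>v\<close>.
\<close>

lemma recurrence_of_tridiagonal_dual: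
  assumes s_tridiagonal: "\<And>i j. i \<le> d \<Longrightarrow> j \<le> d \<Longrightarrow> Suc i < j \<or> Suc j < i \<Longrightarrow> s i j = 0"
    and \<phi>_inj: "inj_on \<phi> {..d}"
  shows "\<exists>\<beta> \<gamma>. \<forall>i. 1 \<le> i \<longrightarrow> i < d \<longrightarrow> \<phi> (i - 1) - \<beta> * \<phi> i + \<phi> (i + 1) = \<gamma>"
proof -
  have \<phi>_iff: "\<phi> i = \<phi> j \<longleftrightarrow> i = j" if "i \<le> d" "j \<le> d" for i j
    using \<phi>_inj that by (auto dest: inj_onD)
  define z where "z n = (\<Sum>k<n. \<theta> k * (\<theta> (Suc k))\<^sup>2 - (\<theta> k)\<^sup>2 * \<theta> (Suc k))" for n
  define Z where "Z x = (\<Sum>i\<le>d. scale (z i * e i x) (w i))" for x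
  have e_Z: "e i (Z x) = z i * e i x" if "i \<le> d" for i x
  proof -
    have "e i (Z x) = (\<Sum>j\<le>d. z j * e j x * e i (w j))"
      by (simp add: Z_def eig.coord_sum eig.coord_scale)
    also have "\<dots> = z i * e i x * e i (w i)"
      by (rule sum_eq_single_term) (use that eig.coord_basis in auto)
    finally show ?thesis using that by (simp add: eig.coord_basis)
  qed
  have Z_linear: "Vector_Spaces.linear scale scale Z"
    unfolding Vector_Spaces.linear_iff
    by (intro conjI allI vector_space_axioms eig.coord_eqI) (simp_all add: eig.coord_simps e_Z algebra_simps)
  interpret Z: Vector_Spaces.linear scale scale Z by (rule Z_linear)
  have Z_A: "Z (A x) = A (Z x)" for x
    by (rule eig.coord_eqI) (simp add: e_Z e_A)
  define X where "X x = A (A (As (A x))) - A (As (A (A x)))" for x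
  have X_eq: "X x = Z (As x) - As (Z x)" for x
  proof -
    have "X = (\<lambda>x. Z (As x) - As (Z x))"
    proof (rule eig.linear_eqI)
      show "Vector_Spaces.linear scale scale X" "Vector_Spaces.linear scale scale (\<lambda>x. Z (As x) - As (Z x))"
        by (simp_all add: Vector_Spaces.linear_iff vector_space_axioms X_def A.add A.scale As.add As.scale
            Z.add Z.scale algebra_simps)
      fix j assume j: "j \<le> d"
      have Zw: "Z (w j) = scale (z j) (w j)"
        using j by (intro eig.coord_eqI) (simp add: e_Z eig.coord_scale eig.coord_basis)
      show "X (w j) = Z (As (w j)) - As (Z (w j))"
      proof (rule eig.coord_eqI)
        fix i assume i: "i \<le> d"
        have l: "e i (X (w j)) = ((\<theta> i)\<^sup>2 * \<theta> j - \<theta> i * (\<theta> j)\<^sup>2) * s i j"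
          using i j by (simp add: X_def eig.coord_simps e_A A_eigenvector A.scale As.scale
              power2_eq_square algebra_simps)
        have r: "e i (Z (As (w j)) - As (Z (w j))) = (z i - z j) * s i j"
          using i j by (simp add: Zw eig.coord_simps e_Z As.scale algebra_simps)
        consider "i = j" | "i = Suc j" | "j = Suc i" | "Suc i < j \<or> Suc j < i" by linarith
        then show "e i (X (w j)) = e i (Z (As (w j)) - As (Z (w j)))"
          unfolding l r using s_tridiagonal[OF i j] by cases (auto simp: z_def power2_eq_square algebra_simps)
      qed
    qed
    then show ?thesis by metis
  qed
  have c_X: "c i (X (v j)) = (\<phi> j - \<phi> i) * c i (Z (v j))" if "i \<le> d" "j \<le> d" for i j
    using that by (simp add: X_eq coord_simps c_As As_eigenvector Z.scale algebra_simps)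
  define p where "p i = a i (i + 1) * a (i + 1) (i + 2) * a (i + 2) (i + 3)" for i
  have p_nz: "p i \<noteq> 0" if "i + 3 \<le> d" for i
    using that A_irreducible[of i] A_irreducible[of "i + 1"] A_irreducible[of "i + 2"]
    by (simp add: p_def numeral_2_eq_2 numeral_3_eq_3)
  \<comment> \<open>In the first term of \<open>X\<close> the factor \<open>As\<close> acts after one step of \<open>A\<close> from \<open>v (i + 3)\<close>, in
    the second after two steps; hence the factors \<open>\<phi> (i + 2)\<close> and \<open>\<phi> (i + 1)\<close>.\<close>
  have X_low: "vanishes_below i (X (v (i + 3)))"
    and X_lead: "c i (X (v (i + 3))) = p i * (\<phi> (i + 2) - \<phi> (i + 1))" if "i + 3 \<le> d" for i
  proof -
    let ?u = "v (Suc (Suc (Suc i)))"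
    have le: "Suc (Suc i) \<le> d" "Suc i < d" "i < d" "Suc (Suc i) < d" "Suc i \<le> d" using that by auto
    have 1: "vanishes_below (Suc (Suc (Suc i))) ?u" using that by (intro vanishes_below_basis) simp
    note A1 = vanishes_below_A[OF 1 le(4)]
    note B1 = vanishes_below_As[OF A1(1) le(1)]
    note C1 = vanishes_below_A[OF B1 le(2)]
    note D1 = vanishes_below_A[OF C1(1) le(3)]
    note A2 = vanishes_below_A[OF A1(1) le(2)]
    note B2 = vanishes_below_As[OF A2(1) le(5)]
    note C2 = vanishes_below_A[OF B2 le(3)]
    show "vanishes_below i (X (v (i + 3)))"
      using D1(1) C2(1) by (simp add: X_def vanishes_below_def coord_diff numeral_3_eq_3)
    show "c i (X (v (i + 3))) = p i * (\<phi> (i + 2) - \<phi> (i + 1))"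
      using D1(2) C1(2) A1(2) C2(2) A2(2) le that
      by (simp add: X_def coord_diff p_def c_As coord_basis numeral_3_eq_3 numeral_2_eq_2 algebra_simps)
  qed
  \<comment> \<open>\<open>p\<close> and \<open>g\<close> are the third superdiagonals of \<open>A\<^sup>3\<close> and \<open>Z\<close>.\<close>
  define g where "g i = c i (Z (v (i + 3)))" for i
  have Z_low: "c i (Z (v j)) = 0" if "i + 3 < j" "j \<le> d" for i j
  proof -
    have "j - 3 + 3 = j" "i < j - 3" using that by auto
    then have "c i (X (v j)) = 0"
      using X_low[of "j - 3"] that by (simp add: vanishes_below_def)
    then show ?thesis using c_X[of i j] \<phi>_iff[of j i] that by simp
  qed
  have g_\<phi>: "(\<phi> (i + 3) - \<phi> i) * g i = p i * (\<phi> (i + 2) - \<phi> (i + 1))" if "i + 3 \<le> d" for i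
    using X_lead[OF that] c_X[of i "i + 3"] that by (simp add: g_def)
  \<comment> \<open>Entry \<open>(i, i + 4)\<close> of \<open>Z A = A Z\<close>.\<close>
  have g_step: "g i * a (i + 3) (i + 4) = a i (i + 1) * g (i + 1)" if "i + 4 \<le> d" for i
  proof -
    have "c i (Z (A (v (i + 4)))) = (\<Sum>k\<le>d. c i (Z (v k)) * a k (i + 4))"
      by (rule coord_of_image) (rule Z_linear)
    also have "\<dots> = c i (Z (v (i + 3))) * a (i + 3) (i + 4)"
    proof (rule sum_eq_single_term)
      fix k assume k: "k \<in> {..d}" "k \<noteq> i + 3"
      then consider "i + 3 < k" | "Suc k < i + 4" by fastforce
      then show "c i (Z (v k)) * a k (i + 4) = 0"
        using k Z_low[of i k] A_tridiagonal[of k "i + 4"] that by cases auto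
    qed (use that in auto)
    finally have l: "c i (Z (A (v (i + 4)))) = g i * a (i + 3) (i + 4)" by (simp add: g_def)
    have "vanishes_below (Suc i) (Z (v (i + 4)))"
      using Z_low that by (auto simp: vanishes_below_def)
    then have "c i (A (Z (v (i + 4)))) = a i (Suc i) * c (Suc i) (Z (v (i + 4)))"
      using vanishes_below_A(2) that by simp
    then show ?thesis using l by (simp add: Z_A g_def add.commute numeral_Bit0 numeral_Bit1)
  qed
  define q where "q = g 0 / p 0"
  have g_p: "g i = q * p i" if "i + 3 \<le> d" for i
    using that
  proof (induction i)
    case 0
    then show ?case using p_nz[of 0] by (simp add: q_def)
  next
    case (Suc i)
    have p_step: "p i * a (i + 3) (i + 4) = a i (i + 1) * p (i + 1)"
      by (simp add: p_def algebra_simps numeral_Bit0 numeral_Bit1)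
    have "a i (i + 1) * g (i + 1) = g i * a (i + 3) (i + 4)" using g_step[of i] Suc.prems by simp
    also have "\<dots> = q * (p i * a (i + 3) (i + 4))" using Suc by simp
    also have "\<dots> = a i (i + 1) * (q * p (i + 1))" by (simp only: p_step mult_ac)
    finally have "g (i + 1) = q * p (i + 1)"
      using A_irreducible[of i] Suc.prems by (subst (asm) mult_left_cancel) auto
    then show ?case by simp
  qed
  have q_\<phi>: "q * (\<phi> (i + 3) - \<phi> i) = \<phi> (i + 2) - \<phi> (i + 1)" if "i + 3 \<le> d" for i
  proof -
    have "p i * (q * (\<phi> (i + 3) - \<phi> i)) = p i * (\<phi> (i + 2) - \<phi> (i + 1))"
      using g_\<phi>[OF that] g_p[OF that] by (simp only: mult_ac)
    then show ?thesis using p_nz[OF that] by (subst (asm) mult_left_cancel)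
  qed
  \<comment> \<open>The induction step below occurs only for \<open>d \<ge> 3\<close>, and then \<open>q\<close> is nonzero because
    \<open>\<phi> 1\<close> and \<open>\<phi> 2\<close> differ.\<close>
  define \<beta> where "\<beta> = inverse q - 1"
  have "\<phi> i - \<beta> * \<phi> (i + 1) + \<phi> (i + 2) = \<phi> 0 - \<beta> * \<phi> 1 + \<phi> 2" if "i + 2 \<le> d" for i
    using that
  proof (induction i)
    case (Suc i)
    have "q * (\<phi> 3 - \<phi> 0) = \<phi> 2 - \<phi> 1" using q_\<phi>[of 0] Suc.prems by (simp add: numeral_2_eq_2)
    then have "q \<noteq> 0" using \<phi>_iff[of 2 1] Suc.prems by auto
    then have "\<phi> (i + 3) - \<phi> i = (\<beta> + 1) * (\<phi> (i + 2) - \<phi> (i + 1))"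
      using q_\<phi>[of i, symmetric] Suc.prems by (simp add: \<beta>_def)
    then have "\<phi> (i + 1) - \<beta> * \<phi> (i + 2) + \<phi> (i + 3) = \<phi> i - \<beta> * \<phi> (i + 1) + \<phi> (i + 2)"
      by (simp only: algebra_simps) (simp add: algebra_simps)
    moreover have "\<phi> i - \<beta> * \<phi> (i + 1) + \<phi> (i + 2) = \<phi> 0 - \<beta> * \<phi> 1 + \<phi> 2"
      using Suc by simp
    ultimately show ?case by (simp add: numeral_3_eq_3)
  qed (simp add: numeral_2_eq_2)
  then have "\<phi> (i - 1) - \<beta> * \<phi> i + \<phi> (i + 1) = \<phi> 0 - \<beta> * \<phi> 1 + \<phi> 2" if "1 \<le> i" "i < d" for i
    using that by (cases i) auto
  then show ?thesis by blast
qed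

end

section \<open>The characterization\<close>

lemma tridiagonal_diagonal_pair_exists:
  fixes scale :: "'k::field \<Rightarrow> 'v::ab_group_add \<Rightarrow> 'v"
  assumes vs: "vector_space scale" and dim: "vector_space.dim scale (UNIV :: 'v set) = d + 1"
    and orth: "orthogonal_idempotents scale d Estar"
    and mf: "multiplicity_free scale d A"
    and ord: "primitive_idempotent_ordering scale d A E"
    and irr: "irreducible_tridiagonal d Estar A"
    and Astar: "Astar = (\<lambda>v. \<Sum>i\<le>d. scale (\<theta>star i) (Estar i v))"
  obtains v c w e \<theta> where "tridiagonal_diagonal_pair scale d v c w e A Astar \<theta> \<theta>star"
    and "\<And>i x. i \<le> d \<Longrightarrow> Estar i x = scale (c i x) (v i)"
    and "\<And>i x. i \<le> d \<Longrightarrow> E i x = scale (e i x) (w i)"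
proof -
  obtain v c where V: "coordinates scale d v c"
    and Estar: "\<And>i x. i \<le> d \<Longrightarrow> Estar i x = scale (c i x) (v i)"
    using coordinates_of_orthogonal_idempotents[OF vs dim orth] by metis
  obtain w e \<theta> where W: "coordinates scale d w e"
    and E: "\<And>i x. i \<le> d \<Longrightarrow> E i x = scale (e i x) (w i)"
    and \<theta>: "\<And>i. i \<le> d \<Longrightarrow> A (w i) = scale (\<theta> i) (w i)" "inj_on \<theta> {..d}"
    using coordinates_of_primitive_idempotents[OF vs dim mf ord] by metis
  interpret V: coordinates scale d v c by fact
  have A: "Vector_Spaces.linear scale scale A" using mf by (simp add: multiplicity_free_def End_def)
  have Astar': "Astar x = (\<Sum>i\<le>d. scale (\<theta>star i * c i x) (v i))" for x
    by (simp add: Astar Estar)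
  have "tridiagonal_diagonal_pair scale d v c w e A Astar \<theta> \<theta>star"
  proof (intro tridiagonal_diagonal_pair.intro tridiagonal_diagonal_pair_axioms.intro V W A \<theta>)
    show "Vector_Spaces.linear scale scale Astar"
      by (simp add: Vector_Spaces.linear_iff vs Astar' V.coord_add V.coord_scale V.scale_sum_right
          V.scale_left_distrib sum.distrib algebra_simps)
    show "Astar (v i) = scale (\<theta>star i) (v i)" if "i \<le> d" for i
    proof -
      have "Astar (v i) = scale (\<theta>star i * c i (v i)) (v i)"
        unfolding Astar' by (rule sum_eq_single_term) (use that V.coord_basis in auto)
      then show ?thesis using that by (simp add: V.coord_basis)
    qed
    show "c i (A (v j)) = 0" if "i \<le> d" "j \<le> d" "Suc i < j \<or> Suc j < i" for i j
    proof -
      have "\<bar>int i - int j\<bar> > 1" using that(3) by linarith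
      then show ?thesis
        using irr that V.projections_sandwich_zero_iff[OF Estar A that(1,2)]
        by (simp add: irreducible_tridiagonal_def)
    qed
    show "c i (A (v (Suc i))) \<noteq> 0 \<and> c (Suc i) (A (v i)) \<noteq> 0" if "Suc i \<le> d" for i
      using irr that V.projections_sandwich_zero_iff[OF Estar A, of i "Suc i"]
        V.projections_sandwich_zero_iff[OF Estar A, of "Suc i" i]
      by (simp add: irreducible_tridiagonal_def)
  qed
  then show ?thesis using that Estar E by blast
qed

text \<open>
  The tail condition refers to the given ordering \<open>E\<close>, the path to another ordering \<open>E'\<close> of the same
  idempotents; both are matched through the common set \<open>S\<close>.
\<close>

lemma tail_of_path_ordering:
  assumes E: "bij_betw E {..d} S" and E': "bij_betw E' {..d} S" and "1 \<le> d"
    and irr: "irreducible_tridiagonal d E' X"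
  shows "tail d E X (E' 0, E' 1)"
proof -
  have inE: "\<exists>i\<le>d. E' k = E i" "\<exists>i\<le>d. E k = E' i" if "k \<le> d" for k
    using that E E' unfolding bij_betw_def by (metis atMost_iff image_iff)+
  have inj: "E i = E j \<longleftrightarrow> i = j" "E' i = E' j \<longleftrightarrow> i = j" if "i \<le> d" "j \<le> d" for i j
    using that E E' by (auto simp: bij_betw_def dest: inj_onD)
  obtain p q where p: "p \<le> d" "E' 0 = E p" and q: "q \<le> d" "E' 1 = E q"
    using inE(1)[of 0] inE(1)[of 1] \<open>1 \<le> d\<close> by auto
  have adj: "\<bar>int i - int j\<bar> \<le> 1"
    if "\<Delta>_adjacent d E X m n" "E m = E' i" "E n = E' j" "i \<le> d" "j \<le> d" for m n i j
    using that irr unfolding \<Delta>_adjacent_def irreducible_tridiagonal_def by (metis not_less)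
  have "p \<noteq> q" using p q inj(2)[of 0 1] \<open>1 \<le> d\<close> by auto
  moreover have "k = q" if k: "\<Delta>_adjacent d E X p k" for k
  proof -
    have "k \<le> d" "k \<noteq> p" using k by (auto simp: \<Delta>_adjacent_def)
    obtain j where j: "j \<le> d" "E k = E' j" using inE(2)[OF \<open>k \<le> d\<close>] by auto
    have "j \<le> 1" using adj[OF k p(2)[symmetric] j(2) _ j(1)] by simp
    moreover have "j \<noteq> 0"
      using j p \<open>k \<noteq> p\<close> \<open>k \<le> d\<close> inj(1)[of k p] by metis
    ultimately have "E k = E q" using j q by (simp add: le_Suc_eq)
    then show ?thesis using inj(1) \<open>k \<le> d\<close> q by simp
  qed
  moreover have "card {k. \<Delta>_adjacent d E X q k \<and> k \<noteq> p} \<le> 1"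
  proof (rule card_le_Suc0_iff_eq[THEN iffD2, unfolded One_nat_def[symmetric]])
    show "finite {k. \<Delta>_adjacent d E X q k \<and> k \<noteq> p}"
      by (rule finite_subset[of _ "{..d}"]) (auto simp: \<Delta>_adjacent_def)
    have two: "k \<le> d \<and> E k = E' 2" if k: "\<Delta>_adjacent d E X q k" "k \<noteq> p" for k
    proof -
      have "k \<le> d" "k \<noteq> q" using k by (auto simp: \<Delta>_adjacent_def)
      obtain j where j: "j \<le> d" "E k = E' j" using inE(2)[OF \<open>k \<le> d\<close>] by auto
      have "j \<le> 2" using adj[OF k(1) q(2)[symmetric] j(2) \<open>1 \<le> d\<close> j(1)] by linarith
      moreover have "j \<noteq> 0" "j \<noteq> 1"
        using j p q k(2) \<open>k \<noteq> q\<close> \<open>k \<le> d\<close> inj(1)[of k p] inj(1)[of k q] by metis+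
      ultimately have "j = 2" by linarith
      then show ?thesis using j \<open>k \<le> d\<close> by simp
    qed
    show "\<forall>k\<in>{k. \<Delta>_adjacent d E X q k \<and> k \<noteq> p}. \<forall>l\<in>{k. \<Delta>_adjacent d E X q k \<and> k \<noteq> p}. k = l"
      using two inj(1) by (metis (mono_tags, lifting) mem_Collect_eq)
  qed
  ultimately show ?thesis using p q unfolding tail_def by auto
qed

theorem theorem5p1:
  fixes scale :: "'k::field \<Rightarrow> 'v::ab_group_add \<Rightarrow> 'v"
    and d :: nat
    and A Astar :: "'v \<Rightarrow> 'v"
    and E Estar :: "nat \<Rightarrow> 'v \<Rightarrow> 'v"
    and \<theta>star :: "nat \<Rightarrow> 'k"
    and P Q :: "'v \<Rightarrow> 'v"
  assumes "vector_space scale"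
    and "d \<ge> 1"
    and "vector_space.dim scale (UNIV :: 'v set) = d + 1"
    and "orthogonal_idempotents scale d Estar"
    and "multiplicity_free scale d A"
    and "primitive_idempotent_ordering scale d A E"
    and "irreducible_tridiagonal d Estar A"
    and "Astar = (\<lambda>v. \<Sum>i\<le>d. scale (\<theta>star i) (Estar i v))"
    and "P \<in> primitive_idempotents scale A"
    and "Q \<in> primitive_idempotents scale A"
    and "P \<noteq> Q"
  shows "Q_polynomial_pair scale d A Astar Estar (P, Q) \<longleftrightarrow>
    (tail d E Astar (P, Q) \<and>
     (\<exists>\<beta>. \<exists>\<gamma>. \<forall>i\<in>{1..d-1}. \<theta>star (i - 1) - \<beta> * \<theta>star i + \<theta>star (i + 1) = \<gamma>) \<and>
     (\<forall>i\<in>{1..d}. \<theta>star 0 \<noteq> \<theta>star i))"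
    (is "?Qpoly \<longleftrightarrow> ?tail \<and> ?rec \<and> ?ne")
proof
  assume ?Qpoly
  then obtain E' where ord': "primitive_idempotent_ordering scale d A E'"
    and L: "Leonard_system scale d A E' Astar Estar" and PQ: "P = E' 0" "Q = E' 1"
    by (auto simp: Q_polynomial_pair_def Q_polynomial_ordering_def)
  have irr': "irreducible_tridiagonal d E' Astar" and mf': "multiplicity_free scale d Astar"
    using L by (auto simp: Leonard_system_def)
  obtain v c w e \<theta> where setting: "tridiagonal_diagonal_pair scale d v c w e A Astar \<theta> \<theta>star"
    and E': "\<And>i x. i \<le> d \<Longrightarrow> E' i x = scale (e i x) (w i)"
    using tridiagonal_diagonal_pair_exists[OF assms(1,3,4,5) ord' assms(7,8)] by metis
  interpret tridiagonal_diagonal_pair scale d v c w e A Astar \<theta> \<theta>star by (rule setting)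
  have "eigenvalues scale Astar = \<theta>star ` {..d}"
    by (rule eigenvalues_of_diagonal[OF As_linear As_eigenvector])
  then have inj: "inj_on \<theta>star {..d}"
    using mf' by (intro eq_card_imp_inj_on) (auto simp: multiplicity_free_def)
  have ?tail
    unfolding PQ using tail_of_path_ordering[OF _ _ assms(2) irr'] assms(6) ord'
    by (simp add: primitive_idempotent_ordering_def)
  moreover have ?rec
  proof -
    have "s i j = 0" if "i \<le> d" "j \<le> d" "Suc i < j \<or> Suc j < i" for i j
    proof -
      have "\<bar>int i - int j\<bar> > 1" using that(3) by linarith
      then show ?thesis
        using irr' that eig.projections_sandwich_zero_iff[OF E' As_linear that(1,2)]
        by (simp add: irreducible_tridiagonal_def)
    qed
    from recurrence_of_tridiagonal_dual[OF this inj] show ?thesis by fastforce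
  qed
  moreover have ?ne using inj by (auto dest!: inj_onD)
  ultimately show "?tail \<and> ?rec \<and> ?ne" by blast
next
  assume R: "?tail \<and> ?rec \<and> ?ne"
  obtain v c w e \<theta> where setting: "tridiagonal_diagonal_pair scale d v c w e A Astar \<theta> \<theta>star"
    and Estar: "\<And>i x. i \<le> d \<Longrightarrow> Estar i x = scale (c i x) (v i)"
    and E: "\<And>i x. i \<le> d \<Longrightarrow> E i x = scale (e i x) (w i)"
    using tridiagonal_diagonal_pair_exists[OF assms(1,3,4,5,6,7,8)] by metis
  interpret tridiagonal_diagonal_pair scale d v c w e A Astar \<theta> \<theta>star by (rule setting)
  have adj: "\<Delta>_adjacent d E Astar i j \<longleftrightarrow> i \<noteq> j \<and> s i j \<noteq> 0" if "i \<le> d" "j \<le> d" for i j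
    using eig.projections_sandwich_zero_iff[OF E As_linear that] that by (simp add: \<Delta>_adjacent_def)
  obtain p q where pq: "p \<le> d" "q \<le> d" "p \<noteq> q" "P = E p" "Q = E q"
    and tail_p: "\<And>k. \<Delta>_adjacent d E Astar p k \<Longrightarrow> k = q"
    and tail_q: "card {k. \<Delta>_adjacent d E Astar q k \<and> k \<noteq> p} \<le> 1"
    using R unfolding tail_def by auto
  obtain \<beta> \<gamma> where rec: "\<forall>i\<in>{1..d-1}. \<theta>star (i - 1) - \<beta> * \<theta>star i + \<theta>star (i + 1) = \<gamma>"
    using R by blast
  obtain \<pi> where \<pi>: "path_segment d \<pi>" "\<pi> 0 = p" "\<pi> 1 = q"
  proof (rule path_of_tail[OF assms(2) pq(1,2,3)])
    show "k = q" if "k \<le> d" "k \<noteq> p" "s p k \<noteq> 0" for k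
      using tail_p adj that pq by auto
    show "k = k'" if "k \<le> d" "k' \<le> d" "k \<notin> {p, q}" "k' \<notin> {p, q}" "s q k \<noteq> 0" "s q k' \<noteq> 0" for k k'
    proof -
      have "finite {k. \<Delta>_adjacent d E Astar q k \<and> k \<noteq> p}"
        by (rule finite_subset[of _ "{..d}"]) (auto simp: \<Delta>_adjacent_def)
      moreover have "k \<in> {k. \<Delta>_adjacent d E Astar q k \<and> k \<noteq> p}"
        "k' \<in> {k. \<Delta>_adjacent d E Astar q k \<and> k \<noteq> p}"
        using that adj pq by auto
      ultimately show ?thesis using tail_q card_le_Suc0_iff_eq by (metis One_nat_def)
    qed
    show "\<theta>star (i - 1) - \<beta> * \<theta>star i + \<theta>star (i + 1) = \<gamma>" if "1 \<le> i" "i < d" for i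
      using rec that by auto
    show "\<theta>star 0 \<noteq> \<theta>star i" if "1 \<le> i" "i \<le> d" for i using R that by auto
  qed
  have bij: "bij_betw \<pi> {..d} {..d}" by (rule full_path_bij) fact
  have inj: "inj_on \<theta>star {..d}" by (rule full_path_eigenvalues_distinct) fact
  have ord': "primitive_idempotent_ordering scale d A (E \<circ> \<pi>)"
    using assms(6) bij_betw_trans[OF bij] by (auto simp: primitive_idempotent_ordering_def)
  have Estar_linear: "Vector_Spaces.linear scale scale (Estar i)" if "i \<le> d" for i
    using assms(4) that by (auto simp: orthogonal_idempotents_def End_def)
  have "multiplicity_free scale d Astar"
    using eigenvalues_of_diagonal[OF As_linear As_eigenvector] inj As_linear
    by (simp add: multiplicity_free_def End_def card_image)
  moreover have "primitive_idempotent_ordering scale d Astar Estar"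
    by (rule primitive_idempotents_of_diagonal[OF As_linear As_eigenvector inj Estar_linear Estar])
  moreover have "irreducible_tridiagonal d (E \<circ> \<pi>) Astar"
    unfolding irreducible_tridiagonal_def
  proof (intro allI impI conjI)
    fix i j assume ij: "i \<le> d" "j \<le> d"
    have *: "(E \<circ> \<pi>) i \<circ> Astar \<circ> (E \<circ> \<pi>) j = (\<lambda>_. 0) \<longleftrightarrow> s (\<pi> i) (\<pi> j) = 0"
      using eig.projections_sandwich_zero_iff[OF E As_linear] path_segment_le[OF \<pi>(1)] ij by simp
    show "(E \<circ> \<pi>) i \<circ> Astar \<circ> (E \<circ> \<pi>) j = (\<lambda>_. 0)" if "1 < \<bar>int i - int j\<bar>"
      unfolding * by (rule full_path_tridiagonal(1)[OF \<pi>(1) ij that])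
    show "(E \<circ> \<pi>) i \<circ> Astar \<circ> (E \<circ> \<pi>) j \<noteq> (\<lambda>_. 0)" if "\<bar>int i - int j\<bar> = 1"
      unfolding * by (rule full_path_tridiagonal(2)[OF \<pi>(1) ij that])
  qed
  ultimately have "Leonard_system scale d A (E \<circ> \<pi>) Astar Estar"
    using assms(5,7) ord' by (simp add: Leonard_system_def)
  then show ?Qpoly
    using ord' \<pi> pq unfolding Q_polynomial_pair_def Q_polynomial_ordering_def
    by (auto intro!: exI[of _ "E \<circ> \<pi>"])
qed

end
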